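(* Let $G$ be a finite graph. There is a bijection between the set of totally non-backtracking closed walks in $G$ and the set of (isomorphism classes of) pyramids of loops in $G$, with concurrency relation edge intersection, whose unique maximal piece is additionally equipped with an edge-simple closed walk (starting directed edge and direction) representing its loop. Moreover, if a walk corresponds to a pyramid, then each edge of $G$ is used the same number of times in the walk as in the labels of the pieces of the pyramid (counting over all pieces).
   Context: Closed walks are sequences of directed edges $(\gamma_1,\dots,\gamma_n)$ with head of $\gamma_j$ equal to tail of $\gamma_{j+1}$ (mod $n$), non-backtracking meaning no edge is immediately followed by its reverse (cyclically). Loop erasure step: if no undirected edge occurs twice, stop successfully; otherwise let $k$ be the largest index such that the undirected edge of $\gamma_k$ occurs at exactly one index $m>k$; if $\gamma_m=\gamma_k$ as directed edges remove $(\gamma_k,\dots,\gamma_{m-1})$, otherwise fail. A closed non-backtracking walk is totally non-backtracking if iterated erasure never fails. A loop is an equivalence class of edge-simple closed walks under cyclic shift and reversal. A heap of loops is a finite poset $(P,\preceq)$ with a labelling $\ell$ of its elements (pieces) by loops such that any two pieces whose labels share an edge are comparable, and $\preceq$ is the transitive closure of these comparabilities. A pyramid is a heap with a unique maximal piece. *)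

theory Defs
  imports Main
begin

text \<open>A finite graph (multi-edges and self-loops allowed): vertex set V, edge set E,
  each edge e having endpoints src e and tgt e. A directed edge is a pair (e, b):
  (e, True) traverses e from src e to tgt e, (e, False) from tgt e to src e.
  The undirected edge underlying a directed edge d is fst d.\<close>

type_synonym 'e dedge = "'e \<times> bool"
type_synonym 'e dwalk = "'e dedge list"

definition finite_graph :: "'v set \<Rightarrow> 'e set \<Rightarrow> ('e \<Rightarrow> 'v) \<Rightarrow> ('e \<Rightarrow> 'v) \<Rightarrow> bool" where
  "finite_graph V E src tgt \<longleftrightarrow> finite V \<and> finite E \<and> (\<forall>e\<in>E. src e \<in> V \<and> tgt e \<in> V)"

definition dtail :: "('e \<Rightarrow> 'v) \<Rightarrow> ('e \<Rightarrow> 'v) \<Rightarrow> 'e dedge \<Rightarrow> 'v" where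
  "dtail src tgt d = (if snd d then src (fst d) else tgt (fst d))"

definition dhead :: "('e \<Rightarrow> 'v) \<Rightarrow> ('e \<Rightarrow> 'v) \<Rightarrow> 'e dedge \<Rightarrow> 'v" where
  "dhead src tgt d = (if snd d then tgt (fst d) else src (fst d))"

definition drev :: "'e dedge \<Rightarrow> 'e dedge" where
  "drev d = (fst d, \<not> snd d)"

text \<open>Closed walk (gamma_1,...,gamma_n), n >= 1, indices taken cyclically (0-based here).\<close>
definition closed_walk :: "'e set \<Rightarrow> ('e \<Rightarrow> 'v) \<Rightarrow> ('e \<Rightarrow> 'v) \<Rightarrow> 'e dwalk \<Rightarrow> bool" where
  "closed_walk E src tgt w \<longleftrightarrow> w \<noteq> [] \<and> (\<forall>d\<in>set w. fst d \<in> E) \<and>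
     (\<forall>j<length w. dhead src tgt (w ! j) = dtail src tgt (w ! (Suc j mod length w)))"

definition non_backtracking :: "'e dwalk \<Rightarrow> bool" where
  "non_backtracking w \<longleftrightarrow> (\<forall>j<length w. w ! (Suc j mod length w) \<noteq> drev (w ! j))"

definition edge_simple :: "'e dwalk \<Rightarrow> bool" where
  "edge_simple w \<longleftrightarrow> distinct (map fst w)"

text \<open>Loop erasure step. kidx w is the largest index k whose undirected edge occurs at
  exactly one later index m = midx w; the step removes gamma_k .. gamma_(m-1).\<close>
definition kidx :: "'e dwalk \<Rightarrow> nat" where
  "kidx w = (GREATEST k. k < length w \<and>
      card {m. k < m \<and> m < length w \<and> fst (w ! m) = fst (w ! k)} = 1)"

definition midx :: "'e dwalk \<Rightarrow> nat" where
  "midx w = (THE m. kidx w < m \<and> m < length w \<and> fst (w ! m) = fst (w ! kidx w))"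

text \<open>erasable w: iterated loop erasure starting from w stops successfully (never fails).\<close>
inductive erasable :: "'e dwalk \<Rightarrow> bool" where
  stop: "edge_simple w \<Longrightarrow> erasable w"
| step: "\<not> edge_simple w \<Longrightarrow> w ! kidx w = w ! midx w \<Longrightarrow>
         erasable (take (kidx w) w @ drop (midx w) w) \<Longrightarrow> erasable w"

definition totally_nb :: "'e set \<Rightarrow> ('e \<Rightarrow> 'v) \<Rightarrow> ('e \<Rightarrow> 'v) \<Rightarrow> 'e dwalk \<Rightarrow> bool" where
  "totally_nb E src tgt w \<longleftrightarrow> closed_walk E src tgt w \<and> non_backtracking w \<and> erasable w"

text \<open>Loops: equivalence classes of edge-simple closed walks under cyclic shift and reversal.\<close>
definition walk_reverse :: "'e dwalk \<Rightarrow> 'e dwalk" where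
  "walk_reverse w = rev (map drev w)"

definition loop_of :: "'e dwalk \<Rightarrow> 'e dwalk set" where
  "loop_of w = {w'. \<exists>i. w' = rotate i w \<or> w' = rotate i (walk_reverse w)}"

definition loops :: "'e set \<Rightarrow> ('e \<Rightarrow> 'v) \<Rightarrow> ('e \<Rightarrow> 'v) \<Rightarrow> 'e dwalk set set" where
  "loops E src tgt = {loop_of w | w. closed_walk E src tgt w \<and> edge_simple w}"

definition loop_edges :: "'e dwalk set \<Rightarrow> 'e set" where
  "loop_edges L = (\<Union>w\<in>L. fst ` set w)"

text \<open>Heaps of loops with concurrency relation = sharing an edge.\<close>
definition is_heap :: "'e set \<Rightarrow> ('e \<Rightarrow> 'v) \<Rightarrow> ('e \<Rightarrow> 'v) \<Rightarrow>
    'p set \<Rightarrow> ('p \<Rightarrow> 'p \<Rightarrow> bool) \<Rightarrow> ('p \<Rightarrow> 'e dwalk set) \<Rightarrow> bool" where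
  "is_heap E src tgt P le lab \<longleftrightarrow>
     finite P \<and>
     (\<forall>p\<in>P. lab p \<in> loops E src tgt) \<and>
     (\<forall>p\<in>P. le p p) \<and>
     (\<forall>p\<in>P. \<forall>q\<in>P. le p q \<and> le q p \<longrightarrow> p = q) \<and>
     (\<forall>p\<in>P. \<forall>q\<in>P. \<forall>r\<in>P. le p q \<and> le q r \<longrightarrow> le p r) \<and>
     (\<forall>p\<in>P. \<forall>q\<in>P. loop_edges (lab p) \<inter> loop_edges (lab q) \<noteq> {} \<longrightarrow> le p q \<or> le q p) \<and>
     (\<forall>p\<in>P. \<forall>q\<in>P. le p q \<longleftrightarrow>
        (p, q) \<in> {(x, y). x \<in> P \<and> y \<in> P \<and> le x y \<and>
                     loop_edges (lab x) \<inter> loop_edges (lab y) \<noteq> {}}\<^sup>*)"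

definition maximal_piece :: "'p set \<Rightarrow> ('p \<Rightarrow> 'p \<Rightarrow> bool) \<Rightarrow> 'p \<Rightarrow> bool" where
  "maximal_piece P le t \<longleftrightarrow> t \<in> P \<and> (\<forall>q\<in>P. le t q \<longrightarrow> q = t)"

definition is_pyramid :: "'e set \<Rightarrow> ('e \<Rightarrow> 'v) \<Rightarrow> ('e \<Rightarrow> 'v) \<Rightarrow>
    'p set \<Rightarrow> ('p \<Rightarrow> 'p \<Rightarrow> bool) \<Rightarrow> ('p \<Rightarrow> 'e dwalk set) \<Rightarrow> bool" where
  "is_pyramid E src tgt P le lab \<longleftrightarrow> is_heap E src tgt P le lab \<and> (\<exists>!t. maximal_piece P le t)"

text \<open>A pyramid whose unique maximal piece is equipped with a representative walk c.\<close>
type_synonym 'e marked_pyramid =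
  "nat set \<times> (nat \<Rightarrow> nat \<Rightarrow> bool) \<times> (nat \<Rightarrow> 'e dwalk set) \<times> 'e dwalk"

definition is_marked_pyramid :: "'e set \<Rightarrow> ('e \<Rightarrow> 'v) \<Rightarrow> ('e \<Rightarrow> 'v) \<Rightarrow> 'e marked_pyramid \<Rightarrow> bool" where
  "is_marked_pyramid E src tgt X = (case X of (P, le, lab, c) \<Rightarrow>
     is_pyramid E src tgt P le lab \<and> (\<exists>t. maximal_piece P le t \<and> c \<in> lab t))"

definition mp_iso :: "'e marked_pyramid \<Rightarrow> 'e marked_pyramid \<Rightarrow> bool" where
  "mp_iso X Y = (case X of (P, le, lab, c) \<Rightarrow> case Y of (P', le', lab', c') \<Rightarrow>
     c = c' \<and> (\<exists>f. bij_betw f P P' \<and> (\<forall>p\<in>P. lab' (f p) = lab p) \<and>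
                  (\<forall>p\<in>P. \<forall>q\<in>P. le' (f p) (f q) \<longleftrightarrow> le p q)))"

definition walk_edge_count :: "'e dwalk \<Rightarrow> 'e \<Rightarrow> nat" where
  "walk_edge_count w e = length (filter (\<lambda>d. fst d = e) w)"

text \<open>Number of times edge e is used in the labels of all pieces (each loop is edge-simple).\<close>
definition pyr_edge_count :: "'e marked_pyramid \<Rightarrow> 'e \<Rightarrow> nat" where
  "pyr_edge_count X e = (case X of (P, le, lab, c) \<Rightarrow> card {p\<in>P. e \<in> loop_edges (lab p)})"

end

theory Submission
  imports Defs
begin

text \<open>
  A loop \<open>L\<close> sharing an edge with a walk can be inserted into it at the last step \<open>d\<close> using an edge
  of \<open>L\<close>, starting \<open>L\<close> with \<open>d\<close> itself. Insertions of edge-disjoint loops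
  commute, so inserting the pieces of a pyramid below its marked top piece, in any order compatible
  with the heap, gives a well-defined walk. An erasure step undoes the rightmost insertion of a
  minimal piece; hence erasure recovers the pyramid up to isomorphism, and conversely every
  successful erasure sequence reads off a pyramid. Insertion creates no backtracking because consecutive
  edges of an edge-simple loop are distinct.
\<close>

text \<open>Only the top piece needs a mark: every other loop receives its starting edge and its
  direction from the step at which it is inserted, since a loop has exactly one representative with
  a prescribed first directed edge on it. Linear extensions are not unique, and this shapes the
  proof twice. Several minimal pieces may be inserted last, so \<open>walk_of\<close> is a relation,
  and its functionality is a diamond argument that closes because distinct minimal pieces are
  incomparable and hence share no edge. Conversely, the piece inserted last need not be the one that
  erasure removes first. The stronger relation \<open>final_insertion\<close> singles out the
  latter, and exchanging insertions brings it to the end. The passage back from walks to pyramids is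
  an induction on pieces. It works because the position of a minimal piece is forced by its label
  and by the heap of the other pieces (\<open>minimal_piece_le_iff\<close>).\<close>

section \<open>Cyclic adjacency conditions on lists\<close>

text \<open>Repeating the head at the end turns a cyclic condition into a linear one, so the append
  rules of \<open>successively\<close> apply; \<open>cyclically_iff_nth\<close> is the link to
  indices modulo the length.\<close>

definition cyclically :: "('a \<Rightarrow> 'a \<Rightarrow> bool) \<Rightarrow> 'a list \<Rightarrow> bool" where
  "cyclically Q w \<longleftrightarrow> w = [] \<or> successively Q (w @ [hd w])"

lemma cyclically_iff_nth:
  "cyclically Q w \<longleftrightarrow> (\<forall>j<length w. Q (w ! j) (w ! (Suc j mod length w)))"
proof (cases "w = []")
  case False
  have "(w @ [hd w]) ! Suc j = w ! (Suc j mod length w)" if "j < length w" for j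
    using that False by (cases "Suc j < length w")
      (auto simp: nth_append hd_conv_nth not_less less_Suc_eq_le dest: le_antisym)
  then show ?thesis
    using False by (auto simp: cyclically_def successively_conv_nth nth_append)
qed (simp add: cyclically_def)

lemma successively_split:
  "successively Q (xs @ d # ys) \<longleftrightarrow> successively Q (xs @ [d]) \<and> successively Q (d # ys)"
  by (auto simp: successively_append_iff successively_Cons)

text \<open>Cut at the occurrences of \<open>d\<close>: the adjacent pairs on the left are those of
  \<open>u @ d # v\<close> together with those of the cycle \<open>d # c\<close>, whose closing pair
  ends in the second \<open>d\<close>. Being an equivalence, this serves both insertion and
  erasure.\<close>

lemma cyclically_insert_cycle:
  "cyclically Q (u @ d # c @ d # v) \<longleftrightarrow> cyclically Q (u @ d # v) \<and> cyclically Q (d # c)"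
proof -
  \<comment> \<open>The closing element is the same for both walks, even if \<open>u\<close> is
    empty; naming it removes the case distinction on \<open>u\<close>.\<close>
  define h where "h = hd (u @ [d])"
  have "hd (u @ d # c @ d # v) = h" "hd (u @ d # v) = h"
    by (simp_all add: h_def hd_append)
  then have "cyclically Q (u @ d # c @ d # v) \<longleftrightarrow> successively Q (u @ d # (c @ d # (v @ [h])))"
    and "cyclically Q (u @ d # v) \<longleftrightarrow> successively Q (u @ d # (v @ [h]))"
    and "cyclically Q (d # c) \<longleftrightarrow> successively Q (d # c @ [d])"
    by (simp_all add: cyclically_def)
  then show ?thesis
    using successively_split[of Q u d "c @ d # v @ [h]"] successively_split[of Q u d "v @ [h]"]
      successively_split[of Q "d # c" d "v @ [h]"] by (simp only: append_Cons) blast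
qed

lemma cyclically_rotate1: "cyclically Q (rotate1 w) \<longleftrightarrow> cyclically Q w"
proof (cases w rule: remdups_adj.cases)
  case (3 x y xs)
  then show ?thesis
    using successively_split[of Q "y # xs" x "[y]"] by (auto simp: cyclically_def)
qed (simp_all add: cyclically_def)

lemma cyclically_rotate: "cyclically Q (rotate i w) \<longleftrightarrow> cyclically Q w"
  by (induction i) (auto simp: cyclically_rotate1)

lemma cyclically_rev: "cyclically Q (rev w) \<longleftrightarrow> cyclically (\<lambda>x y. Q y x) w"
proof (cases w)
  case (Cons x xs)
  have "cyclically Q (rev w) \<longleftrightarrow> cyclically Q (x # rev xs)"
    using cyclically_rotate1[of Q "x # rev xs"] Cons by simp
  also have "\<dots> \<longleftrightarrow> successively Q (rev (w @ [hd w]))"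
    using Cons by (simp add: cyclically_def)
  finally show ?thesis
    unfolding successively_rev using Cons by (simp add: cyclically_def)
qed (simp add: cyclically_def)

lemma cyclically_map: "cyclically Q (map f w) \<longleftrightarrow> cyclically (\<lambda>x y. Q (f x) (f y)) w"
proof (cases "w = []")
  case False
  then have "map f w @ [hd (map f w)] = map f (w @ [hd w])"
    by (simp add: hd_map)
  then show ?thesis
    using False by (simp only: cyclically_def successively_map) simp
qed (simp add: cyclically_def)

section \<open>Closed walks under rotation and reversal\<close>

lemma closed_walk_alt:
  "closed_walk E src tgt w \<longleftrightarrow> w \<noteq> [] \<and> fst ` set w \<subseteq> E \<and>
     cyclically (\<lambda>x y. dhead src tgt x = dtail src tgt y) w"
  by (auto simp: closed_walk_def cyclically_iff_nth)

lemma non_backtracking_alt: "non_backtracking w \<longleftrightarrow> cyclically (\<lambda>x y. y \<noteq> drev x) w"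
  by (simp add: non_backtracking_def cyclically_iff_nth)

lemma fst_drev [simp]: "fst (drev d) = fst d"
  and drev_drev [simp]: "drev (drev d) = d"
  and drev_neq [simp]: "drev d \<noteq> d"
  by (cases d; simp add: drev_def)+

text \<open>A backtrack puts one undirected edge at two cyclically consecutive positions.
  Distinctness identifies these positions, and then a directed edge would be its own reverse; the
  direction flag forbids this even for a self-loop of the graph.\<close>

lemma non_backtracking_if_edge_simple:
  assumes "edge_simple w"
  shows "non_backtracking w"
  unfolding non_backtracking_def
proof (intro allI impI notI)
  fix j assume j: "j < length w" and eq: "w ! (Suc j mod length w) = drev (w ! j)"
  have "Suc j mod length w < length w"
    using j by (intro mod_less_divisor) linarith
  moreover have "map fst w ! (Suc j mod length w) = map fst w ! j"
    using j eq calculation by simp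
  ultimately have "Suc j mod length w = j"
    using assms j by (simp add: edge_simple_def distinct_conv_nth) metis
  then show False
    using eq by (metis drev_neq)
qed

lemma closed_walk_rotate: "closed_walk E src tgt (rotate i w) \<longleftrightarrow> closed_walk E src tgt w"
  by (simp add: closed_walk_alt cyclically_rotate)

lemma edge_simple_rotate: "edge_simple (rotate i w) \<longleftrightarrow> edge_simple w"
  by (simp add: edge_simple_def rotate_map[symmetric])

lemma dhead_drev [simp]: "dhead src tgt (drev d) = dtail src tgt d"
  and dtail_drev [simp]: "dtail src tgt (drev d) = dhead src tgt d"
  by (simp_all add: dhead_def dtail_def drev_def)

lemma map_fst_reverse: "map fst (walk_reverse w) = rev (map fst w)"
  by (simp add: walk_reverse_def rev_map[symmetric] comp_def)

lemma closed_walk_reverse: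
  assumes "closed_walk E src tgt w"
  shows "closed_walk E src tgt (walk_reverse w)"
proof -
  let ?Q = "\<lambda>x y. dhead src tgt x = dtail src tgt y"
  have "cyclically ?Q (walk_reverse w) \<longleftrightarrow> cyclically (\<lambda>x y. dtail src tgt y = dhead src tgt x) w"
    by (simp only: walk_reverse_def cyclically_rev cyclically_map dhead_drev dtail_drev)
  also have "(\<lambda>x y. dtail src tgt y = dhead src tgt x) = ?Q"
    by (intro ext) (rule eq_commute)
  finally have "cyclically ?Q (walk_reverse w) \<longleftrightarrow> cyclically ?Q w" .
  moreover have "fst ` set (walk_reverse w) = fst ` set w"
    using arg_cong[OF map_fst_reverse[of w], of set] by (simp only: set_map set_rev)
  moreover have "walk_reverse w = [] \<longleftrightarrow> w = []"
    by (simp add: walk_reverse_def)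
  ultimately show ?thesis
    using assms unfolding closed_walk_alt by simp
qed

lemma edge_simple_reverse: "edge_simple (walk_reverse w) \<longleftrightarrow> edge_simple w"
  by (simp add: edge_simple_def map_fst_reverse)

lemma walk_reverse_reverse [simp]: "walk_reverse (walk_reverse w) = w"
  by (simp add: walk_reverse_def rev_map[symmetric] comp_def)

lemma rotate_walk_reverse: "\<exists>j. walk_reverse (rotate i w) = rotate j (walk_reverse w)"
proof (induction i)
  case 0
  show ?case by (rule exI[of _ 0]) simp
next
  case (Suc i)
  have "\<exists>j. walk_reverse (rotate1 x) = rotate j (walk_reverse x)" for x :: "'a dwalk"
  proof (cases x)
    case (Cons a y)
    \<comment> \<open>One rotation before the reversal is one backward rotation after it, that is
      \<open>length y\<close> forward rotations of a list of length
      \<open>Suc (length y)\<close>.\<close>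
    have "walk_reverse (rotate1 x) = rotate (length y) (walk_reverse x)"
      using rotate_append[of "map drev (rev y)" "[drev a]"] Cons
      by (simp add: walk_reverse_def rev_map)
    then show ?thesis ..
  qed (auto simp: walk_reverse_def)
  then show ?case
    using Suc by (metis rotate_rotate rotate_Suc)
qed

section \<open>Loops and their representatives\<close>

lemma mem_loop_of_self: "w \<in> loop_of w"
  by (auto simp: loop_of_def intro: exI[of _ 0])

lemma rotate_in_loop_of: "w' \<in> loop_of w \<Longrightarrow> rotate i w' \<in> loop_of w"
  by (auto simp: loop_of_def rotate_rotate)

lemma reverse_in_loop_of: "w' \<in> loop_of w \<Longrightarrow> walk_reverse w' \<in> loop_of w"
  unfolding loop_of_def using rotate_walk_reverse walk_reverse_reverse
  by (smt (verit) mem_Collect_eq)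

lemma loop_of_trans: "w' \<in> loop_of w \<Longrightarrow> loop_of w' \<subseteq> loop_of w"
  unfolding loop_of_def[of w'] using rotate_in_loop_of reverse_in_loop_of by blast

lemma rotate_inverse: "\<exists>j. rotate j (rotate i w) = w"
proof (cases "w = []")
  case False
  \<comment> \<open>Reducing \<open>i\<close> modulo the length first keeps the natural-number
    subtraction exact.\<close>
  have "(length w - i mod length w + i) mod length w = 0"
    using False by (metis le_add_diff_inverse2 length_greater_0_conv mod_add_right_eq mod_le_divisor mod_self)
  then show ?thesis
    by (metis rotate_rotate rotate_id)
qed simp

lemma loop_of_sym: "w' \<in> loop_of w \<Longrightarrow> w \<in> loop_of w'"
proof -
  assume w': "w' \<in> loop_of w"
  then obtain i where "w' = rotate i w \<or> w' = rotate i (walk_reverse w)"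
    by (auto simp: loop_of_def)
  moreover obtain j k where "rotate j (rotate i w) = w"
      "rotate k (rotate i (walk_reverse w)) = walk_reverse w"
    using rotate_inverse by blast
  ultimately have "w \<in> loop_of w' \<or> walk_reverse w \<in> loop_of w'"
    using rotate_in_loop_of[OF mem_loop_of_self] by metis
  then show "w \<in> loop_of w'"
    using reverse_in_loop_of walk_reverse_reverse by metis
qed

lemma loop_of_eq: "w' \<in> loop_of w \<Longrightarrow> loop_of w' = loop_of w"
  by (meson loop_of_sym loop_of_trans subset_antisym)


text \<open>Rotation and reversal preserve closedness, edge-simplicity and the set of edges, so any
  member can act as the representative.\<close>

lemma loopsE:
  assumes "L \<in> loops E src tgt" "r \<in> L"
  obtains "closed_walk E src tgt r" "edge_simple r" "L = loop_of r" "loop_edges L = fst ` set r"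
proof -
  from assms obtain w where w: "closed_walk E src tgt w" "edge_simple w" "L = loop_of w"
    by (auto simp: loops_def)
  with assms have L: "L = loop_of r"
    by (simp add: loop_of_eq)
  have "fst ` set (walk_reverse r) = fst ` set r"
    using arg_cong[OF map_fst_reverse[of r], of set] by simp
  then have edges: "fst ` set x = fst ` set r" if "x \<in> L" for x
    using that unfolding L loop_of_def by (elim CollectE exE disjE) simp_all
  have "closed_walk E src tgt r" "edge_simple r"
    using assms(2) w closed_walk_reverse[OF w(1)]
    by (auto simp: loop_of_def closed_walk_rotate edge_simple_rotate edge_simple_reverse)
  moreover have "loop_edges L = fst ` set r"
    using assms(2) edges unfolding loop_edges_def by blast
  ultimately show ?thesis
    using that L by blast
qed

lemma loop_of_in_loops:
  "closed_walk E src tgt w \<Longrightarrow> edge_simple w \<Longrightarrow> loop_of w \<in> loops E src tgt"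
  by (auto simp: loops_def)

text \<open>Distinct edges force a rotation that keeps the first step to be trivial. A reversed
  representative is excluded, because it traverses the edge of \<open>d\<close> only as
  \<open>drev d\<close>. With \<open>loop_start_exists\<close> this makes insertion
  deterministic.\<close>

lemma loop_start_unique:
  assumes "L \<in> loops E src tgt" "d # c \<in> L" "d # c' \<in> L"
  shows "c = c'"
proof -
  let ?r = "d # c"
  obtain simple: "edge_simple ?r" and L: "L = loop_of ?r"
    using assms(1,2) by (rule loopsE)
  from assms(3) L obtain i where "d # c' = rotate i ?r \<or> d # c' = rotate i (walk_reverse ?r)"
    by (auto simp: loop_of_def)
  then show ?thesis
  proof
    assume eq: "d # c' = rotate i ?r"
    define j where "j = i mod length ?r"
    have "?r ! j = ?r ! 0"
      using hd_rotate_conv_nth[of ?r i] unfolding eq[symmetric] j_def by simp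
    moreover have "distinct ?r" "j < length ?r"
      using simple by (auto simp: edge_simple_def j_def distinct_map)
    ultimately have "j = 0"
      using nth_eq_iff_index_eq[of ?r j 0] by simp
    then show ?thesis
      using eq rotate_conv_mod[of i ?r] by (simp add: j_def)
  next
    assume "d # c' = rotate i (walk_reverse ?r)"
    then have "d \<in> set (walk_reverse ?r)"
      by (metis list.set_intros(1) set_rotate)
    then have "d \<in> drev ` set ?r"
      by (simp only: walk_reverse_def set_rev set_map)
    then obtain x where x: "x \<in> set ?r" "d = drev x"
      by blast
    moreover have "x = d"
      using simple x by (auto simp: edge_simple_def image_iff)
    ultimately show ?thesis
      by (metis drev_neq)
  qed
qed

text \<open>Some representative traverses the edge of \<open>d\<close>; reverse it if the direction
  is wrong, then rotate \<open>d\<close> to the front.\<close>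

lemma loop_start_exists:
  assumes "L \<in> loops E src tgt" "fst d \<in> loop_edges L"
  obtains c where "d # c \<in> L"
proof -
  from assms(2) obtain r x where r: "r \<in> L" "x \<in> set r" "fst x = fst d"
    by (auto simp: loop_edges_def)
  have L: "L = loop_of r"
    using assms(1) r(1) by (rule loopsE)
  have "\<exists>r'\<in>L. d \<in> set r'"
  proof (cases "x = d")
    case False
    then have "d = drev x"
      using r(3) by (cases d; cases x) (auto simp: drev_def)
    then have "d \<in> set (walk_reverse r)"
      using r(2) by (simp add: walk_reverse_def)
    then show ?thesis
      using L r(1) reverse_in_loop_of by blast
  qed (use r in blast)
  then obtain r' where r': "r' \<in> L" "d \<in> set r'"
    by blast
  then obtain a b where "r' = a @ d # b"
    by (meson split_list)
  then have "d # b @ a \<in> L"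
    using rotate_in_loop_of[of r' r "length a"] rotate_append[of a "d # b"] r'(1) L by simp
  then show ?thesis
    by (rule that)
qed

section \<open>Inserting a loop into a walk\<close>

text \<open>Since \<open>v\<close> avoids \<open>L\<close>, the loop is inserted at the last step of \<open>w'\<close> that uses one of its edges.\<close>
definition insertion :: "'e dwalk set \<Rightarrow> 'e dwalk \<Rightarrow> 'e dwalk \<Rightarrow> bool" where
  "insertion L w' w \<longleftrightarrow> (\<exists>u d c v. w' = u @ d # v \<and> w = u @ d # c @ d # v \<and> d # c \<in> L \<and>
     loop_edges L \<inter> fst ` set v = {})"

lemma insertionE:
  assumes "insertion L w' w"
  obtains u d c v where "w' = u @ d # v" "w = u @ d # c @ d # v" "d # c \<in> L"
    "loop_edges L \<inter> fst ` set v = {}"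
  using assms unfolding insertion_def by (elim exE conjE) (rule that)

text \<open>This compares two insertion points in one walk: they coincide, or one lies in the tail
  behind the other.\<close>

lemma append_Cons_eq_append_ConsE:
  assumes "u1 @ d1 # v1 = u2 @ d2 # v2"
  obtains "u1 = u2" "d1 = d2" "v1 = v2"
  | x where "u2 = u1 @ d1 # x" "v1 = x @ d2 # v2"
  | x where "u1 = u2 @ d2 # x" "v2 = x @ d1 # v1"
proof -
  have "u1 = u2 \<and> d1 = d2 \<and> v1 = v2 \<or> (\<exists>x. u2 = u1 @ d1 # x \<and> v1 = x @ d2 # v2) \<or>
    (\<exists>x. u1 = u2 @ d2 # x \<and> v2 = x @ d1 # v1)"
    using assms
  proof (induction u1 arbitrary: u2)
    case Nil
    then show ?case by (cases u2) auto
  next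
    case (Cons y u1)
    then show ?case by (cases u2) auto
  qed
  then show ?thesis
    using that by blast
qed

text \<open>If the insertion points differed, the later one would put an edge of \<open>L\<close>
  into the tail of the earlier one, which avoids \<open>L\<close>.\<close>

lemma insertion_unique:
  assumes L: "L \<in> loops E src tgt" and insertion: "insertion L w' w1" "insertion L w' w2"
  shows "w1 = w2"
proof -
  from insertion(1) obtain u1 d1 c1 v1 where 1: "w' = u1 @ d1 # v1" "w1 = u1 @ d1 # c1 @ d1 # v1"
    "d1 # c1 \<in> L" "loop_edges L \<inter> fst ` set v1 = {}"
    by (rule insertionE)
  from insertion(2) obtain u2 d2 c2 v2 where 2: "w' = u2 @ d2 # v2" "w2 = u2 @ d2 # c2 @ d2 # v2"
    "d2 # c2 \<in> L" "loop_edges L \<inter> fst ` set v2 = {}"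
    by (rule insertionE)
  have d: "fst d1 \<in> loop_edges L" "fst d2 \<in> loop_edges L"
    using 1 2 by (force simp: loop_edges_def)+
  have "u1 = u2 \<and> d1 = d2 \<and> v1 = v2"
    by (rule append_Cons_eq_append_ConsE[OF trans[OF 1(1)[symmetric] 2(1)]]) (use d 1(4) 2(4) in auto)
  then show ?thesis
    using 1 2 loop_start_unique[OF L] by auto
qed

lemma insertion_exists:
  assumes L: "L \<in> loops E src tgt" and "loop_edges L \<inter> fst ` set w' \<noteq> {}"
  obtains w where "insertion L w' w"
proof -
  have "\<exists>x\<in>set w'. fst x \<in> loop_edges L"
    using assms(2) by auto
  then obtain u d v where w': "w' = u @ d # v" "fst d \<in> loop_edges L" "\<forall>x\<in>set v. fst x \<notin> loop_edges L"
    by (rule split_list_last_propE)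
  obtain c where "d # c \<in> L"
    using loop_start_exists[OF L w'(2)] .
  with w' have "insertion L w' (u @ d # c @ d # v)"
    unfolding insertion_def by blast
  then show ?thesis ..
qed

text \<open>Disjointness rules out a common insertion point. The earlier insertion leaves the tail
  behind the later point untouched, and the later insertion adds to the tail behind the earlier
  point only edges foreign to the other loop. So both points remain the last admissible
  ones.\<close>

lemma insertion_commute:
  assumes L: "L1 \<in> loops E src tgt" "L2 \<in> loops E src tgt" and disj: "loop_edges L1 \<inter> loop_edges L2 = {}"
    and insertion: "insertion L1 w w1" "insertion L2 w w2"
  shows "\<exists>w'. insertion L2 w1 w' \<and> insertion L1 w2 w'"
proof -
  from insertion(1) obtain u1 d1 c1 v1 where 1: "w = u1 @ d1 # v1" "w1 = u1 @ d1 # c1 @ d1 # v1"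
    "d1 # c1 \<in> L1" "loop_edges L1 \<inter> fst ` set v1 = {}"
    by (rule insertionE)
  from insertion(2) obtain u2 d2 c2 v2 where 2: "w = u2 @ d2 # v2" "w2 = u2 @ d2 # c2 @ d2 # v2"
    "d2 # c2 \<in> L2" "loop_edges L2 \<inter> fst ` set v2 = {}"
    by (rule insertionE)
  have e: "loop_edges L1 = fst ` set (d1 # c1)" "loop_edges L2 = fst ` set (d2 # c2)"
    using L 1(3) 2(3) by (blast elim: loopsE)+
  consider x where "u2 = u1 @ d1 # x" "v1 = x @ d2 # v2" | x where "u1 = u2 @ d2 # x" "v2 = x @ d1 # v1"
    by (rule append_Cons_eq_append_ConsE[OF trans[OF 1(1)[symmetric] 2(1)]]) (use disj e in auto)
  then show ?thesis
  proof cases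
    case order: 1
    have "insertion L2 w1 (u1 @ d1 # c1 @ d1 # x @ d2 # c2 @ d2 # v2)"
      unfolding insertion_def using 1 2 order by (intro exI[of _ "u1 @ d1 # c1 @ d1 # x"]) auto
    moreover have "insertion L1 w2 (u1 @ d1 # c1 @ d1 # x @ d2 # c2 @ d2 # v2)"
      unfolding insertion_def using 1 2 order disj e by (intro exI[of _ u1]) auto
    ultimately show ?thesis by blast
  next
    case order: 2
    have "insertion L1 w2 (u2 @ d2 # c2 @ d2 # x @ d1 # c1 @ d1 # v1)"
      unfolding insertion_def using 1 2 order by (intro exI[of _ "u2 @ d2 # c2 @ d2 # x"]) auto
    moreover have "insertion L2 w1 (u2 @ d2 # c2 @ d2 # x @ d1 # c1 @ d1 # v1)"
      unfolding insertion_def using 1 2 order disj e by (intro exI[of _ u2]) auto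
    ultimately show ?thesis by blast
  qed
qed

section \<open>A single erasure step as the inverse of an insertion\<close>

text \<open>Take the step just before the longest suffix with distinct edges; its edge has to recur
  in that suffix.\<close>

lemma non_edge_simple_split:
  "\<not> edge_simple w \<Longrightarrow>
    \<exists>u d c d' v. w = u @ d # c @ d' # v \<and> fst d = fst d' \<and> distinct (map fst (c @ d' # v))"
proof (induction w)
  case (Cons x w)
  show ?case
  proof (cases "edge_simple w")
    case True
    then have "fst x \<in> fst ` set w"
      using Cons.prems by (simp add: edge_simple_def)
    then obtain d' where d': "d' \<in> set w" "fst x = fst d'"
      by blast
    then obtain c v where "w = c @ d' # v"
      by (meson split_list)
    then have "x # w = [] @ x # c @ d' # v \<and> fst x = fst d' \<and> distinct (map fst (c @ d' # v))"
      using True d' by (simp add: edge_simple_def)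
    then show ?thesis
      by (intro exI)
  next
    case False
    then obtain u d c d' v where
      "w = u @ d # c @ d' # v \<and> fst d = fst d' \<and> distinct (map fst (c @ d' # v))"
      using Cons.IH[OF False] by (elim exE) (rule that)
    then have "x # w = (x # u) @ d # c @ d' # v \<and> fst d = fst d' \<and> distinct (map fst (c @ d' # v))"
      by simp
    then show ?thesis
      by (intro exI)
  qed
qed (simp add: edge_simple_def)

text \<open>Inside the suffix behind \<open>d\<close> no edge recurs, so no later index qualifies
  for \<open>kidx\<close>, while the edge of \<open>d\<close> recurs there only at
  \<open>d'\<close>.\<close>

lemma kidx_midx_eq:
  assumes w: "w = u @ d # c @ d' # v" and d: "fst d = fst d'" and dist: "distinct (map fst (c @ d' # v))"
  shows "kidx w = length u" "midx w = Suc (length u + length c)"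
proof -
  let ?k = "length u" and ?m = "Suc (length u + length c)"
  let ?S = "\<lambda>k. {m. k < m \<and> m < length w \<and> fst (w ! m) = fst (w ! k)}"
  have len: "?m < length w"
    using w by simp
  have tl: "drop (Suc ?k) w = c @ d' # v"
    using w by simp
  have inj: "i = j" if "?k < i" "?k < j" "i < length w" "j < length w" "fst (w ! i) = fst (w ! j)" for i j
  proof -
    define i' j' where "i' = i - Suc ?k" and "j' = j - Suc ?k"
    have ij: "i = Suc ?k + i'" "j = Suc ?k + j'"
      using that by (auto simp: i'_def j'_def)
    have "map fst (drop (Suc ?k) w) ! i' = map fst (drop (Suc ?k) w) ! j'"
      using that ij by simp
    then have "i' = j'"
      using dist that ij unfolding tl[symmetric] by (subst (asm) nth_eq_iff_index_eq) auto
    then show ?thesis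
      using ij by simp
  qed
  have nk: "w ! ?k = d" and nm: "w ! ?m = d'"
    using w by (simp_all add: nth_append)
  have S: "?S ?k = {?m}"
    using inj[of _ ?m] len nk nm d by auto
  have kidx: "kidx w = ?k"
    unfolding kidx_def
  proof (rule Greatest_equality)
    show "?k < length w \<and> card (?S ?k) = 1"
      using S len by simp
    fix k assume k: "k < length w \<and> card (?S k) = 1"
    show "k \<le> ?k"
    proof (rule ccontr)
      assume "\<not> k \<le> ?k"
      then have "fst (w ! m) \<noteq> fst (w ! k)" if "k < m" "m < length w" for m
        using inj[of k m] that by auto
      then have "?S k = {}"
        by blast
      with k show False
        by (metis card.empty zero_neq_one)
    qed
  qed
  show "kidx w = ?k"
    by (fact kidx)
  show "midx w = ?m"
    unfolding midx_def kidx using S by (intro the_equality) auto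
qed

text \<open>The additional condition on \<open>v\<close> makes the erasure step remove exactly the inserted loop.\<close>
definition final_insertion :: "'e dwalk set \<Rightarrow> 'e dwalk \<Rightarrow> 'e dwalk \<Rightarrow> bool" where
  "final_insertion L w' w \<longleftrightarrow> (\<exists>u d c v. w' = u @ d # v \<and> w = u @ d # c @ d # v \<and> d # c \<in> L \<and>
     loop_edges L \<inter> fst ` set v = {} \<and> distinct (map fst v))"

lemma final_insertion_insertion: "final_insertion L w' w \<Longrightarrow> insertion L w' w"
  unfolding final_insertion_def insertion_def by blast

lemma insertion_not_edge_simple: "insertion L w' w \<Longrightarrow> \<not> edge_simple w"
  unfolding insertion_def edge_simple_def by auto

text \<open>Loop and remaining walk are both expressed through \<open>w\<close> alone, so uniqueness
  follows without comparing two decompositions.\<close>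

lemma final_insertionE:
  assumes "final_insertion L w' w" "L \<in> loops E src tgt"
  obtains "L = loop_of (take (midx w - kidx w) (drop (kidx w) w))"
    "w' = take (kidx w) w @ drop (midx w) w" "w ! kidx w = w ! midx w"
proof -
  from assms(1) obtain u d c v where
    *: "w' = u @ d # v" "w = u @ d # c @ d # v" "d # c \<in> L" "loop_edges L \<inter> fst ` set v = {}" "distinct (map fst v)"
    unfolding final_insertion_def by (elim exE conjE) (rule that)
  have L: "edge_simple (d # c)" "L = loop_of (d # c)" "loop_edges L = fst ` set (d # c)"
    using assms(2) *(3) by (blast elim: loopsE)+
  have "distinct (map fst (c @ d # v))"
    using L * by (auto simp: edge_simple_def)
  then have k: "kidx w = length u" "midx w = Suc (length u + length c)"
    using *(2) by (intro kidx_midx_eq[of w u d c d v]; simp)+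
  show ?thesis
    by (rule that) (use * k L in \<open>simp_all add: nth_append\<close>)
qed

lemma final_insertion_unique:
  assumes "final_insertion L1 w1 w" "L1 \<in> loops E src tgt" "final_insertion L2 w2 w" "L2 \<in> loops E src tgt"
  shows "L1 = L2" "w1 = w2"
  using final_insertionE[OF assms(1,2)] final_insertionE[OF assms(3,4)] by metis+

lemma erasable_final_insertion:
  assumes "final_insertion L w' w" "L \<in> loops E src tgt" "erasable w'"
  shows "erasable w"
  using assms(1,2)
proof (rule final_insertionE)
  assume "w' = take (kidx w) w @ drop (midx w) w" "w ! kidx w = w ! midx w"
  then show ?thesis
    using assms(3) insertion_not_edge_simple[OF final_insertion_insertion[OF assms(1)]] by (auto intro: erasable.step)
qed

lemma closed_walk_insert_cycle:
  "closed_walk E src tgt (u @ d # c @ d # v) \<longleftrightarrow>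
     closed_walk E src tgt (u @ d # v) \<and> closed_walk E src tgt (d # c)"
  by (auto simp: closed_walk_alt cyclically_insert_cycle)

lemma non_backtracking_insert_cycle:
  "non_backtracking (u @ d # c @ d # v) \<longleftrightarrow> non_backtracking (u @ d # v) \<and> non_backtracking (d # c)"
  by (simp add: non_backtracking_alt cyclically_insert_cycle)

text \<open>Equality of the directed edges closes the removed segment into a cycle
  \<open>d # c\<close>. It is edge-simple because the edges of \<open>c @ d' # v\<close> are
  distinct, and that same distinctness makes the tail \<open>v\<close> avoid the cycle.\<close>

lemma erasure_step:
  assumes "closed_walk E src tgt w" "\<not> edge_simple w" "w ! kidx w = w ! midx w"
  defines "w' \<equiv> take (kidx w) w @ drop (midx w) w"
  obtains L where "L \<in> loops E src tgt" "final_insertion L w' w" "closed_walk E src tgt w'"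
proof -
  obtain u d c d' v where
    w: "w = u @ d # c @ d' # v" "fst d = fst d'" "distinct (map fst (c @ d' # v))"
    using non_edge_simple_split[OF assms(2)] by (elim exE conjE) (rule that)
  note k = kidx_midx_eq[OF w]
  have d: "d' = d"
    using assms(3) k w(1) by (simp add: nth_append)
  have w': "w' = u @ d # v"
    using w k d by (simp add: w'_def)
  have cl: "closed_walk E src tgt w'" "closed_walk E src tgt (d # c)"
    using assms(1) w(1) w' d by (simp_all add: closed_walk_insert_cycle)
  have "edge_simple (d # c)"
    using w d by (auto simp: edge_simple_def)
  with cl(2) have L: "loop_of (d # c) \<in> loops E src tgt"
    by (rule loop_of_in_loops)
  have "loop_edges (loop_of (d # c)) = fst ` set (d # c)"
    using L mem_loop_of_self by (rule loopsE)
  moreover have "fst ` set (d # c) \<inter> fst ` set v = {}" "distinct (map fst v)"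
    using w(3) d by auto
  ultimately have "w' = u @ d # v \<and> w = u @ d # c @ d # v \<and> d # c \<in> loop_of (d # c) \<and>
      loop_edges (loop_of (d # c)) \<inter> fst ` set v = {} \<and> distinct (map fst v)"
    using w(1) w' d mem_loop_of_self by simp
  then have "final_insertion (loop_of (d # c)) w' w"
    unfolding final_insertion_def by (intro exI)
  with L cl(1) show ?thesis
    by (intro that)
qed

section \<open>Effect of an insertion on edge counts and closedness; exchange of insertions\<close>

lemma walk_edge_count_simps [simp]:
  "walk_edge_count [] e = 0"
  "walk_edge_count (d # w) e = (if fst d = e then 1 else 0) + walk_edge_count w e"
  "walk_edge_count (u @ w) e = walk_edge_count u e + walk_edge_count w e"
  by (simp_all add: walk_edge_count_def)

lemma walk_edge_count_edge_simple:
  "edge_simple w \<Longrightarrow> walk_edge_count w e = (if e \<in> fst ` set w then 1 else 0)"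
  by (induction w) (auto simp: edge_simple_def)

lemma walk_edge_count_pos_iff: "walk_edge_count w e > 0 \<longleftrightarrow> e \<in> fst ` set w"
  by (induction w) auto

lemma walk_edge_count_insertion:
  assumes "insertion L w' w" "L \<in> loops E src tgt"
  shows "walk_edge_count w e = (if e \<in> loop_edges L then 1 else 0) + walk_edge_count w' e"
proof -
  from assms(1) obtain u d c v where *: "w' = u @ d # v" "w = u @ d # c @ d # v" "d # c \<in> L"
    by (rule insertionE)
  have "edge_simple (d # c)" "loop_edges L = fst ` set (d # c)"
    using assms(2) *(3) by (blast elim: loopsE)+
  \<comment> \<open>The inserted segment is \<open>c @ [d]\<close>, up to order the representative
    \<open>d # c\<close>, which uses each of its edges once.\<close>
  then have "walk_edge_count (d # c) e = (if e \<in> loop_edges L then 1 else 0)"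
    by (simp only: walk_edge_count_edge_simple)
  then show ?thesis
    unfolding * by simp
qed

lemma insertion_closed_nb:
  assumes "insertion L w' w" "L \<in> loops E src tgt" "closed_walk E src tgt w'" "non_backtracking w'"
  shows "closed_walk E src tgt w" "non_backtracking w"
proof -
  from assms(1) obtain u d c v where *: "w' = u @ d # v" "w = u @ d # c @ d # v" "d # c \<in> L"
    by (rule insertionE)
  have "closed_walk E src tgt (d # c)" "edge_simple (d # c)"
    using assms(2) *(3) by (blast elim: loopsE)+
  with assms(3,4) show "closed_walk E src tgt w" "non_backtracking w"
    unfolding * closed_walk_insert_cycle non_backtracking_insert_cycle
    by (simp_all add: non_backtracking_if_edge_simple)
qed

lemma final_insertion_commute:
  assumes "L1 \<in> loops E src tgt" "L2 \<in> loops E src tgt"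
    and "insertion L1 w' w" "\<not> final_insertion L1 w' w" "final_insertion L2 w2 w'"
  shows "loop_edges L1 \<inter> loop_edges L2 = {}" "\<exists>w1. insertion L1 w2 w1 \<and> final_insertion L2 w1 w"
proof -
  from assms(3) obtain u d c v where 1: "w' = u @ d # v" "w = u @ d # c @ d # v"
    "d # c \<in> L1" "loop_edges L1 \<inter> fst ` set v = {}"
    by (rule insertionE)
  from assms(5) obtain u2 d2 c2 v2 where 2: "w2 = u2 @ d2 # v2" "w' = u2 @ d2 # c2 @ d2 # v2"
    "d2 # c2 \<in> L2" "loop_edges L2 \<inter> fst ` set v2 = {}" "distinct (map fst v2)"
    unfolding final_insertion_def by (elim exE conjE) (rule that)
  have L2: "edge_simple (d2 # c2)" "loop_edges L2 = fst ` set (d2 # c2)"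
    using assms(2) 2(3) by (blast elim: loopsE)+
  have dist2: "distinct (map fst (c2 @ d2 # v2))"
    using L2 2(4,5) by (auto simp: edge_simple_def)
  have dist: "\<not> distinct (map fst v)"
  proof
    assume "distinct (map fst v)"
    with 1 have "final_insertion L1 w' w"
      unfolding final_insertion_def by (intro exI conjI)
    with assms(4) show False ..
  qed
  from 1(1) 2(2) have "u @ d # v = u2 @ d2 # (c2 @ d2 # v2)"
    by simp
  \<comment> \<open>The tail behind the first \<open>d2\<close> has distinct edges and
    \<open>v\<close> does not, so \<open>v\<close> is no suffix of that tail. Hence \<open>d\<close>
    comes strictly before the first \<open>d2\<close>, and the whole copy of the second loop lies in
    \<open>v\<close>.\<close>
  then obtain x where x: "u2 = u @ d # x" "v = x @ d2 # c2 @ d2 # v2"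
  proof (rule append_Cons_eq_append_ConsE)
    assume "v = c2 @ d2 # v2"
    with dist dist2 show ?thesis by simp
  next
    fix x assume "c2 @ d2 # v2 = x @ d # v"
    with dist2 have "distinct (map fst (x @ d # v))" by simp
    with dist show ?thesis by simp
  qed (rule that)
  show disj: "loop_edges L1 \<inter> loop_edges L2 = {}"
    using 1(4) x(2) L2(2) by auto
  let ?w1 = "(u @ d # c @ d # x) @ d2 # v2"
  have "w2 = u @ d # (x @ d2 # v2)" "?w1 = u @ d # c @ d # (x @ d2 # v2)"
    "loop_edges L1 \<inter> fst ` set (x @ d2 # v2) = {}"
    using 2 x 1(4) by auto
  with 1(3) have "insertion L1 w2 ?w1"
    unfolding insertion_def by (intro exI conjI)
  moreover have "w = (u @ d # c @ d # x) @ d2 # c2 @ d2 # v2"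
    using 1 x by simp
  with 2 have "final_insertion L2 ?w1 w"
    unfolding final_insertion_def by (intro exI conjI) (rule refl)
  ultimately show "\<exists>w1. insertion L1 w2 w1 \<and> final_insertion L2 w1 w"
    by (intro exI conjI)
qed

section \<open>Heaps and their minimal pieces\<close>

definition conc :: "('p \<Rightarrow> 'e dwalk set) \<Rightarrow> 'p \<Rightarrow> 'p \<Rightarrow> bool" where
  "conc lab p q \<longleftrightarrow> loop_edges (lab p) \<inter> loop_edges (lab q) \<noteq> {}"

definition minimal_piece :: "'p set \<Rightarrow> ('p \<Rightarrow> 'p \<Rightarrow> bool) \<Rightarrow> 'p \<Rightarrow> bool" where
  "minimal_piece P le p \<longleftrightarrow> p \<in> P \<and> (\<forall>q\<in>P. le q p \<longrightarrow> q = p)"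

lemma conc_sym: "conc lab p q \<longleftrightarrow> conc lab q p"
  by (auto simp: conc_def)

context
  fixes E :: "'e set" and src tgt :: "'e \<Rightarrow> 'v"
begin

abbreviation heap :: "'p set \<Rightarrow> ('p \<Rightarrow> 'p \<Rightarrow> bool) \<Rightarrow> ('p \<Rightarrow> 'e dwalk set) \<Rightarrow> bool" where
  "heap \<equiv> is_heap E src tgt"

lemma heapD:
  assumes "heap P le lab"
  shows heap_finite: "finite P"
    and heap_loops: "p \<in> P \<Longrightarrow> lab p \<in> loops E src tgt"
    and heap_refl: "p \<in> P \<Longrightarrow> le p p"
    and heap_antisym: "le p q \<Longrightarrow> le q p \<Longrightarrow> p \<in> P \<Longrightarrow> q \<in> P \<Longrightarrow> p = q"
    and heap_trans: "le p q \<Longrightarrow> le q r \<Longrightarrow> p \<in> P \<Longrightarrow> q \<in> P \<Longrightarrow> r \<in> P \<Longrightarrow> le p r"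
    and heap_comparable: "conc lab p q \<Longrightarrow> p \<in> P \<Longrightarrow> q \<in> P \<Longrightarrow> le p q \<or> le q p"
    and heap_chain: "p \<in> P \<Longrightarrow> q \<in> P \<Longrightarrow>
      le p q \<longleftrightarrow> (p, q) \<in> {(x, y). x \<in> P \<and> y \<in> P \<and> le x y \<and> conc lab x y}\<^sup>*"
proof -
  let ?R = "{(x, y). x \<in> P \<and> y \<in> P \<and> le x y \<and> conc lab x y}"
  have "finite P \<and>
     (\<forall>p\<in>P. lab p \<in> loops E src tgt) \<and>
     (\<forall>p\<in>P. le p p) \<and>
     (\<forall>p\<in>P. \<forall>q\<in>P. le p q \<and> le q p \<longrightarrow> p = q) \<and>
     (\<forall>p\<in>P. \<forall>q\<in>P. \<forall>r\<in>P. le p q \<and> le q r \<longrightarrow> le p r) \<and>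
     (\<forall>p\<in>P. \<forall>q\<in>P. conc lab p q \<longrightarrow> le p q \<or> le q p) \<and>
     (\<forall>p\<in>P. \<forall>q\<in>P. le p q \<longleftrightarrow> (p, q) \<in> ?R\<^sup>*)"
    using assms unfolding is_heap_def conc_def .
  then have *: "finite P" "\<forall>p\<in>P. lab p \<in> loops E src tgt" "\<forall>p\<in>P. le p p"
     "\<forall>p\<in>P. \<forall>q\<in>P. le p q \<and> le q p \<longrightarrow> p = q"
     "\<forall>p\<in>P. \<forall>q\<in>P. \<forall>r\<in>P. le p q \<and> le q r \<longrightarrow> le p r"
     "\<forall>p\<in>P. \<forall>q\<in>P. conc lab p q \<longrightarrow> le p q \<or> le q p"
     "\<forall>p\<in>P. \<forall>q\<in>P. le p q \<longleftrightarrow> (p, q) \<in> ?R\<^sup>*"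
    by - (elim conjE, assumption)+
  show "finite P" by (fact *(1))
  show "p \<in> P \<Longrightarrow> lab p \<in> loops E src tgt" using *(2) by blast
  show "p \<in> P \<Longrightarrow> le p p" using *(3) by blast
  show "le p q \<Longrightarrow> le q p \<Longrightarrow> p \<in> P \<Longrightarrow> q \<in> P \<Longrightarrow> p = q" using *(4) by blast
  show "le p q \<Longrightarrow> le q r \<Longrightarrow> p \<in> P \<Longrightarrow> q \<in> P \<Longrightarrow> r \<in> P \<Longrightarrow> le p r" using *(5) by blast
  show "conc lab p q \<Longrightarrow> p \<in> P \<Longrightarrow> q \<in> P \<Longrightarrow> le p q \<or> le q p" using *(6) by blast
  show "p \<in> P \<Longrightarrow> q \<in> P \<Longrightarrow> le p q \<longleftrightarrow> (p, q) \<in> ?R\<^sup>*" using *(7) by blast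
qed

text \<open>The first proper step of a concurrency chain from \<open>p\<close> to \<open>q\<close>.
  Together with \<open>heapI\<close>, this local property replaces the reflexive transitive closure
  in all later arguments.\<close>

lemma heap_cover:
  assumes H: "heap P le lab" and "le p q" "p \<in> P" "q \<in> P" "p \<noteq> q"
  shows "\<exists>y\<in>P. y \<noteq> p \<and> le p y \<and> conc lab p y \<and> le y q"
proof -
  let ?R = "{(x, y). x \<in> P \<and> y \<in> P \<and> le x y \<and> conc lab x y}"
  have "(p, q) \<in> ?R\<^sup>*"
    using heap_chain[OF H] assms by blast
  then show ?thesis
    using \<open>p \<noteq> q\<close>
  proof (induction rule: converse_rtrancl_induct)
    case (step a b)
    show ?case
    proof (cases "a = b")
      case False
      then show ?thesis
        using step.hyps heap_chain[OF H, of b q] \<open>q \<in> P\<close> by (intro bexI[of _ b]) auto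
    qed (use step in blast)
  qed simp
qed

text \<open>The covering property lets one climb from \<open>p\<close> towards \<open>q\<close> by
  concurrent steps; the set of pieces above the current one shrinks strictly, so finiteness ends the
  climb.\<close>

lemma heapI:
  assumes fin: "finite P" and "\<And>p. p \<in> P \<Longrightarrow> lab p \<in> loops E src tgt"
    and refl: "\<And>p. p \<in> P \<Longrightarrow> le p p"
    and antisym: "\<And>p q. p \<in> P \<Longrightarrow> q \<in> P \<Longrightarrow> le p q \<Longrightarrow> le q p \<Longrightarrow> p = q"
    and trans: "\<And>p q r. p \<in> P \<Longrightarrow> q \<in> P \<Longrightarrow> r \<in> P \<Longrightarrow> le p q \<Longrightarrow> le q r \<Longrightarrow> le p r"
    and comp: "\<And>p q. p \<in> P \<Longrightarrow> q \<in> P \<Longrightarrow> conc lab p q \<Longrightarrow> le p q \<or> le q p"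
    and cover: "\<And>p q. p \<in> P \<Longrightarrow> q \<in> P \<Longrightarrow> le p q \<Longrightarrow> p \<noteq> q \<Longrightarrow>
      \<exists>y\<in>P. y \<noteq> p \<and> le p y \<and> conc lab p y \<and> le y q"
  shows "heap P le lab"
proof -
  let ?R = "{(x, y). x \<in> P \<and> y \<in> P \<and> le x y \<and> conc lab x y}"
  have "(p, q) \<in> ?R\<^sup>*" if "le p q" "p \<in> P" "q \<in> P" for p q
    using that
  proof (induction "card {x\<in>P. le p x}" arbitrary: p rule: less_induct)
    case less
    show ?case
    proof (cases "p = q")
      case False
      then obtain y where y: "y \<in> P" "y \<noteq> p" "le p y" "conc lab p y" "le y q"
        using cover less.prems by blast
      have "{x\<in>P. le y x} \<subseteq> {x\<in>P. le p x}"
        using trans y less.prems by blast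
      moreover have "p \<in> {x\<in>P. le p x}" "p \<notin> {x\<in>P. le y x}"
        using refl antisym y less.prems by blast+
      ultimately have "{x\<in>P. le y x} \<subset> {x\<in>P. le p x}"
        by blast
      then have "card {x\<in>P. le y x} < card {x\<in>P. le p x}"
        using fin by (intro psubset_card_mono) simp_all
      then have "(y, q) \<in> ?R\<^sup>*"
        using less y by blast
      then show ?thesis
        using y less.prems by (intro converse_rtrancl_into_rtrancl[of p y]) simp_all
    qed simp
  qed
  moreover have "le p q" if "(p, q) \<in> ?R\<^sup>*" "p \<in> P" for p q
  proof -
    from that(1) have "q \<in> P \<and> le p q"
    proof (induction rule: rtrancl_induct)
      case base
      then show ?case using refl that(2) by simp
    next
      case (step y z)
      then show ?case using trans that(2) by blast
    qed
    then show ?thesis ..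
  qed
  ultimately have "\<forall>p\<in>P. \<forall>q\<in>P. le p q \<longleftrightarrow> (p, q) \<in> ?R\<^sup>*"
    by blast
  moreover have "\<forall>p\<in>P. \<forall>q\<in>P. le p q \<and> le q p \<longrightarrow> p = q"
    using antisym by blast
  moreover have "\<forall>p\<in>P. \<forall>q\<in>P. \<forall>r\<in>P. le p q \<and> le q r \<longrightarrow> le p r"
    using trans by blast
  moreover have "\<forall>p\<in>P. \<forall>q\<in>P. conc lab p q \<longrightarrow> le p q \<or> le q p"
    using comp by blast
  moreover have "\<forall>p\<in>P. lab p \<in> loops E src tgt" "\<forall>p\<in>P. le p p"
    using assms(2) refl by blast+
  ultimately show ?thesis
    using fin unfolding is_heap_def conc_def by (intro conjI)
qed

lemma heap_maximal_above:
  assumes H: "heap P le lab" and "q \<in> P"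
  shows "\<exists>m. maximal_piece P le m \<and> le q m"
  using assms(2)
proof (induction "card {x\<in>P. le q x}" arbitrary: q rule: less_induct)
  case less
  show ?case
  proof (cases "maximal_piece P le q")
    case True
    then show ?thesis using heap_refl[OF H] less.prems by blast
  next
    case False
    then obtain y where y: "y \<in> P" "le q y" "y \<noteq> q"
      using less.prems by (auto simp: maximal_piece_def)
    have "{x\<in>P. le y x} \<subseteq> {x\<in>P. le q x}"
      using heap_trans[OF H] y less.prems by blast
    moreover have "q \<in> {x\<in>P. le q x}" "q \<notin> {x\<in>P. le y x}"
      using heap_refl[OF H] heap_antisym[OF H] y less.prems by blast+
    ultimately have "{x\<in>P. le y x} \<subset> {x\<in>P. le q x}"
      by blast
    then have "card {x\<in>P. le y x} < card {x\<in>P. le q x}"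
      using heap_finite[OF H] by (intro psubset_card_mono) simp_all
    then obtain m where "maximal_piece P le m" "le y m"
      using less.hyps y(1) by blast
    moreover have "m \<in> P"
      using calculation by (simp add: maximal_piece_def)
    ultimately show ?thesis
      using heap_trans[OF H] y less.prems by blast
  qed
qed

lemma heap_minimal_exists:
  assumes H: "heap P le lab" and "q \<in> P"
  shows "\<exists>p. minimal_piece P le p"
  using assms(2)
proof (induction "card {x\<in>P. le x q}" arbitrary: q rule: less_induct)
  case less
  show ?case
  proof (cases "minimal_piece P le q")
    case False
    then obtain y where y: "y \<in> P" "le y q" "y \<noteq> q"
      using less.prems by (auto simp: minimal_piece_def)
    have "{x\<in>P. le x y} \<subseteq> {x\<in>P. le x q}"
      using heap_trans[OF H] y less.prems by blast
    moreover have "q \<in> {x\<in>P. le x q}" "q \<notin> {x\<in>P. le x y}"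
      using heap_refl[OF H] heap_antisym[OF H] y less.prems by blast+
    ultimately have "{x\<in>P. le x y} \<subset> {x\<in>P. le x q}"
      by blast
    then have "card {x\<in>P. le x y} < card {x\<in>P. le x q}"
      using heap_finite[OF H] by (intro psubset_card_mono) simp_all
    then show ?thesis
      using less.hyps y(1) by blast
  qed blast
qed

lemma minimal_pieces_not_conc:
  assumes "heap P le lab" "minimal_piece P le p" "minimal_piece P le q" "p \<noteq> q"
  shows "\<not> conc lab p q"
  using assms heap_comparable[OF assms(1), of p q] by (auto simp: minimal_piece_def)

text \<open>A piece concurrent with \<open>p\<close> is comparable to it, and by minimality it lies
  above. So the order around \<open>p\<close> can be rebuilt from the labels and the order on the
  other pieces.\<close>

lemma minimal_piece_le_iff:
  assumes H: "heap P le lab" and p: "minimal_piece P le p" and "q \<in> P"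
  shows "le p q \<longleftrightarrow> q = p \<or> (\<exists>y\<in>P - {p}. conc lab p y \<and> le y q)"
proof
  have pP: "p \<in> P"
    using p by (simp add: minimal_piece_def)
  show "q = p \<or> (\<exists>y\<in>P - {p}. conc lab p y \<and> le y q)" if "le p q"
    using heap_cover[OF H that pP \<open>q \<in> P\<close>] by blast
  show "le p q" if "q = p \<or> (\<exists>y\<in>P - {p}. conc lab p y \<and> le y q)"
    using that
  proof
    assume "\<exists>y\<in>P - {p}. conc lab p y \<and> le y q"
    then obtain y where y: "y \<in> P" "y \<noteq> p" "conc lab p y" "le y q"
      by blast
    then have "le p y"
      using heap_comparable[OF H, of p y] p pP by (auto simp: minimal_piece_def)
    then show ?thesis
      using heap_trans[OF H] y pP \<open>q \<in> P\<close> by blast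
  qed (use heap_refl[OF H] pP in simp)
qed

text \<open>Chains between other pieces never pass through \<open>p\<close>, since nothing but
  \<open>p\<close> lies below it.\<close>

lemma heap_remove_minimal:
  assumes H: "heap P le lab" and p: "minimal_piece P le p"
  shows "heap (P - {p}) le lab"
proof (rule heapI)
  fix a b assume ab: "a \<in> P - {p}" "b \<in> P - {p}"
  show "\<exists>y\<in>P - {p}. y \<noteq> a \<and> le a y \<and> conc lab a y \<and> le y b" if le: "le a b" and neq: "a \<noteq> b"
  proof -
    obtain y where y: "y \<in> P" "y \<noteq> a" "le a y" "conc lab a y" "le y b"
      using heap_cover[OF H le _ _ neq] ab by blast
    then have "y \<noteq> p"
      using p ab by (auto simp: minimal_piece_def)
    with y show ?thesis by blast
  qed
  show "le a b \<or> le b a" if "conc lab a b"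
    using heap_comparable[OF H that] ab by blast
  show "a = b" if "le a b" "le b a"
    using heap_antisym[OF H that] ab by blast
  show "le a c" if "c \<in> P - {p}" "le a b" "le b c" for c
    using heap_trans[OF H that(2,3)] that(1) ab by blast
qed (use heap_finite[OF H] heap_loops[OF H] heap_refl[OF H] in auto)

section \<open>Pyramids and removal of a minimal piece\<close>

abbreviation pyramid :: "nat set \<Rightarrow> (nat \<Rightarrow> nat \<Rightarrow> bool) \<Rightarrow> (nat \<Rightarrow> 'e dwalk set) \<Rightarrow> 'e dwalk \<Rightarrow> bool" where
  "pyramid P le lab c \<equiv> is_marked_pyramid E src tgt (P, le, lab, c)"

text \<open>In a finite poset every piece lies below some maximal one, so a unique maximal piece is
  a greatest piece.\<close>

lemma pyramid_iff:
  "pyramid P le lab c \<longleftrightarrow> heap P le lab \<and> (\<exists>t\<in>P. (\<forall>q\<in>P. le q t) \<and> c \<in> lab t)"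
proof
  assume pyr: "pyramid P le lab c"
  then have H: "heap P le lab"
    by (simp add: is_marked_pyramid_def is_pyramid_def)
  from pyr have "\<exists>!t. maximal_piece P le t"
    by (simp add: is_marked_pyramid_def is_pyramid_def)
  moreover from pyr obtain t where t: "maximal_piece P le t" "c \<in> lab t"
    unfolding is_marked_pyramid_def prod.case by blast
  ultimately have unique: "m = t" if "maximal_piece P le m" for m
    using that by blast
  have "le q t" if "q \<in> P" for q
    using heap_maximal_above[OF H that] unique by blast
  moreover have "t \<in> P"
    using t(1) by (simp add: maximal_piece_def)
  ultimately show "heap P le lab \<and> (\<exists>t\<in>P. (\<forall>q\<in>P. le q t) \<and> c \<in> lab t)"
    using H t(2) by blast
next
  assume R: "heap P le lab \<and> (\<exists>t\<in>P. (\<forall>q\<in>P. le q t) \<and> c \<in> lab t)"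
  then have H: "heap P le lab" ..
  from R obtain t where t: "t \<in> P" "\<And>q. q \<in> P \<Longrightarrow> le q t" "c \<in> lab t"
    by blast
  have max: "maximal_piece P le t"
    using t heap_antisym[OF H] by (auto simp: maximal_piece_def)
  moreover have "m = t" if "maximal_piece P le m" for m
    using that t by (auto simp: maximal_piece_def)
  ultimately show "pyramid P le lab c"
    using H t(3) unfolding is_marked_pyramid_def is_pyramid_def prod.case by blast
qed

lemma pyramid_heap: "pyramid P le lab c \<Longrightarrow> heap P le lab"
  by (simp add: pyramid_iff)

text \<open>The top survives, and the chain from \<open>p\<close> to it begins with a concurrent
  piece. This piece guarantees that the walk of the remaining pyramid offers an edge at which
  \<open>lab p\<close> can be inserted.\<close>

lemma pyramid_remove_minimal:
  assumes pyr: "pyramid P le lab c" and p: "minimal_piece P le p" and "P \<noteq> {p}"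
  shows "pyramid (P - {p}) le lab c" "\<exists>q\<in>P - {p}. conc lab p q"
proof -
  note H = pyramid_heap[OF pyr]
  from pyr obtain t where t: "t \<in> P" "\<And>q. q \<in> P \<Longrightarrow> le q t" "c \<in> lab t"
    unfolding pyramid_iff by blast
  have pP: "p \<in> P"
    using p by (simp add: minimal_piece_def)
  have "t \<noteq> p"
  proof
    assume "t = p"
    then have "q = p" if "q \<in> P" for q
      using p t(2)[OF that] that by (simp add: minimal_piece_def)
    with pP \<open>P \<noteq> {p}\<close> show False by blast
  qed
  then show "pyramid (P - {p}) le lab c"
    unfolding pyramid_iff using heap_remove_minimal[OF H p] t by blast
  show "\<exists>q\<in>P - {p}. conc lab p q"
    using minimal_piece_le_iff[OF H p t(1)] t(2)[OF pP] \<open>t \<noteq> p\<close> by blast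
qed

section \<open>The walk of a pyramid: existence and uniqueness\<close>

text \<open>Inserting the pieces from the top downwards, along some linear extension of the order.\<close>
inductive walk_of :: "(nat \<Rightarrow> nat \<Rightarrow> bool) \<Rightarrow> (nat \<Rightarrow> 'e dwalk set) \<Rightarrow> 'e dwalk \<Rightarrow>
    nat set \<Rightarrow> 'e dwalk \<Rightarrow> bool" for le lab c where
  single: "pyramid {t} le lab c \<Longrightarrow> walk_of le lab c {t} c"
| add: "pyramid P le lab c \<Longrightarrow> minimal_piece P le p \<Longrightarrow> P \<noteq> {p} \<Longrightarrow>
    walk_of le lab c (P - {p}) w' \<Longrightarrow> insertion (lab p) w' w \<Longrightarrow> walk_of le lab c P w"

lemma walk_of_pyramid: "walk_of le lab c P w \<Longrightarrow> pyramid P le lab c"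
  by (induction rule: walk_of.induct)

lemma pyramid_singleton_mark:
  assumes "pyramid {t} le lab c"
  shows "closed_walk E src tgt c" "edge_simple c" "loop_edges (lab t) = fst ` set c" "lab t = loop_of c"
proof -
  have *: "lab t \<in> loops E src tgt" "c \<in> lab t"
    using assms heap_loops[OF pyramid_heap[OF assms]] by (auto simp: pyramid_iff)
  show "closed_walk E src tgt c" "edge_simple c" "loop_edges (lab t) = fst ` set c" "lab t = loop_of c"
    using * by (blast elim: loopsE)+
qed

lemma walk_of_edge_count:
  "walk_of le lab c P w \<Longrightarrow> walk_edge_count w e = card {p\<in>P. e \<in> loop_edges (lab p)}"
proof (induction rule: walk_of.induct)
  case (single t)
  have "{p \<in> {t}. e \<in> loop_edges (lab p)} = (if e \<in> loop_edges (lab t) then {t} else {})"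
    by auto
  then show ?case
    using pyramid_singleton_mark[OF single] by (simp add: walk_edge_count_edge_simple)
next
  case (add P p w' w)
  note H = pyramid_heap[OF add.hyps(1)]
  have p: "p \<in> P"
    using add.hyps(2) by (simp add: minimal_piece_def)
  have "{q\<in>P. e \<in> loop_edges (lab q)} =
      (if e \<in> loop_edges (lab p) then {p} else {}) \<union> {q\<in>P - {p}. e \<in> loop_edges (lab q)}"
    using p by auto
  also have "card \<dots> = (if e \<in> loop_edges (lab p) then 1 else 0) + walk_edge_count w' e"
    using add.IH heap_finite[OF H] by (subst card_Un_disjoint) auto
  finally show ?case
    using walk_edge_count_insertion[OF add.hyps(5) heap_loops[OF H p]] by simp
qed

text \<open>An edge occurs exactly if its count is positive, so this is read off from
  \<open>walk_of_edge_count\<close>.\<close>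

lemma walk_of_edges:
  assumes "walk_of le lab c P w"
  shows "fst ` set w = (\<Union>p\<in>P. loop_edges (lab p))"
proof -
  have "finite P"
    using assms by (intro heap_finite pyramid_heap walk_of_pyramid)
  then have "e \<in> fst ` set w \<longleftrightarrow> (\<exists>p\<in>P. e \<in> loop_edges (lab p))" for e
    unfolding walk_edge_count_pos_iff[symmetric] walk_of_edge_count[OF assms]
    by (auto simp: card_gt_0_iff)
  then show ?thesis by blast
qed

lemma walk_of_closed:
  "walk_of le lab c P w \<Longrightarrow> closed_walk E src tgt w \<and> non_backtracking w"
proof (induction rule: walk_of.induct)
  case (single t)
  note c = pyramid_singleton_mark[OF single]
  show ?case
    using c(1) non_backtracking_if_edge_simple[OF c(2)] ..
next
  case (add P p w' w)
  have "lab p \<in> loops E src tgt"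
    using heap_loops[OF pyramid_heap[OF add.hyps(1)]] add.hyps(2) by (simp add: minimal_piece_def)
  with add.IH show ?case
    using insertion_closed_nb[OF add.hyps(5)] by blast
qed

lemma walk_of_add_exists:
  assumes pyr: "pyramid P le lab c" and p: "minimal_piece P le p" and "P \<noteq> {p}"
    and w': "walk_of le lab c (P - {p}) w'"
  obtains w where "insertion (lab p) w' w" "walk_of le lab c P w"
proof -
  have "lab p \<in> loops E src tgt"
    using heap_loops[OF pyramid_heap[OF pyr]] p by (simp add: minimal_piece_def)
  moreover have "loop_edges (lab p) \<inter> fst ` set w' \<noteq> {}"
    using pyramid_remove_minimal(2)[OF assms(1-3)] unfolding walk_of_edges[OF w'] conc_def by blast
  ultimately obtain w where "insertion (lab p) w' w"
    by (rule insertion_exists)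
  then show ?thesis
    using that walk_of.add[OF assms] by blast
qed

lemma walk_of_exists:
  assumes "pyramid P le lab c"
  obtains w where "walk_of le lab c P w"
proof -
  have "\<exists>w. walk_of le lab c P w"
    using assms
  proof (induction "card P" arbitrary: P rule: less_induct)
    case less
    note H = pyramid_heap[OF less.prems]
    obtain p where p: "minimal_piece P le p"
      using heap_minimal_exists[OF H] less.prems unfolding pyramid_iff by blast
    show ?case
    proof (cases "P = {p}")
      case True
      then show ?thesis
        using walk_of.single less.prems by blast
    next
      case False
      have "card (P - {p}) < card P"
        using heap_finite[OF H] p by (intro card_Diff1_less) (simp_all add: minimal_piece_def)
      then obtain w' where "walk_of le lab c (P - {p}) w'"
        using less.hyps pyramid_remove_minimal(1)[OF less.prems p False] by blast
      then show ?thesis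
        using walk_of_add_exists[OF less.prems p False] by blast
    qed
  qed
  then show ?thesis
    using that by blast
qed

lemma walk_of_cases_minimal:
  assumes "walk_of le lab c P w"
  obtains t where "P = {t}" "w = c"
  | p w' where "minimal_piece P le p" "P \<noteq> {p}" "walk_of le lab c (P - {p}) w'" "insertion (lab p) w' w"
  using assms by (cases rule: walk_of.cases) blast+

text \<open>The piece concurrent with \<open>p\<close> cannot be the minimal piece \<open>q\<close>,
  so a third piece remains. Thus the two removals can be made in either order.\<close>

lemma pyramid_remove_two:
  assumes pyr: "pyramid P le lab c" and p: "minimal_piece P le p" "P \<noteq> {p}"
    and q: "minimal_piece P le q" "P \<noteq> {q}" and "p \<noteq> q"
  shows "minimal_piece (P - {p}) le q" "P - {p} \<noteq> {q}"
proof -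
  show q': "minimal_piece (P - {p}) le q"
    using q(1) \<open>p \<noteq> q\<close> by (auto simp: minimal_piece_def)
  obtain y where y: "y \<in> P - {p}" "conc lab p y"
    using pyramid_remove_minimal(2)[OF pyr p] by blast
  have "\<not> conc lab p q"
    using minimal_pieces_not_conc[OF pyramid_heap[OF pyr]] p q \<open>p \<noteq> q\<close> by blast
  with y(2) have "y \<noteq> q" by blast
  with y(1) show "P - {p} \<noteq> {q}" by (metis singletonD)
qed

text \<open>A diamond argument on the pieces inserted last: if they differ, both are minimal and can
  be removed together, and inserting them into the common smaller walk in the two orders gives the
  same result.\<close>

lemma walk_of_unique:
  "walk_of le lab c P w1 \<Longrightarrow> walk_of le lab c P w2 \<Longrightarrow> w1 = w2"
proof (induction "card P" arbitrary: P w1 w2 rule: less_induct)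
  case less
  have pyr: "pyramid P le lab c"
    using less.prems by (blast intro: walk_of_pyramid)
  note H = pyramid_heap[OF pyr]
  have single: "w = c" if "P = {t}" "walk_of le lab c P w" for t w
    using that(2)
  proof (cases rule: walk_of_cases_minimal)
    case (2 p w')
    with that(1) show ?thesis by (auto simp: minimal_piece_def)
  qed
  have card: "card (P - {p}) < card P" if "minimal_piece P le p" for p
    using heap_finite[OF H] that by (intro card_Diff1_less) (simp_all add: minimal_piece_def)
  have loops: "lab p \<in> loops E src tgt" if "minimal_piece P le p" for p
    using heap_loops[OF H] that by (simp add: minimal_piece_def)
  show ?case
  proof (cases "\<exists>t. P = {t}")
    case True
    then show ?thesis
      using single less.prems by metis
  next
    case False
    obtain p v1 where p: "minimal_piece P le p" "P \<noteq> {p}" "walk_of le lab c (P - {p}) v1" "insertion (lab p) v1 w1"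
      using less.prems(1) False by (cases rule: walk_of_cases_minimal) blast+
    obtain q v2 where q: "minimal_piece P le q" "P \<noteq> {q}" "walk_of le lab c (P - {q}) v2" "insertion (lab q) v2 w2"
      using less.prems(2) False by (cases rule: walk_of_cases_minimal) blast+
    show ?thesis
    proof (cases "p = q")
      case True
      then have "v1 = v2"
        using less.hyps[OF card[OF p(1)]] p q by blast
      with True show ?thesis
        using insertion_unique[OF loops[OF p(1)]] p q by blast
    next
      case neq: False
      note pq = pyramid_remove_two[OF pyr p(1,2) q(1,2) neq]
      note qp = pyramid_remove_two[OF pyr q(1,2) p(1,2) neq[symmetric]]
      note pyrp = pyramid_remove_minimal(1)[OF pyr p(1,2)]
      note pyrq = pyramid_remove_minimal(1)[OF pyr q(1,2)]
      obtain v where v: "walk_of le lab c (P - {p} - {q}) v"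
        using walk_of_exists pyramid_remove_minimal(1)[OF pyrp pq] by blast
      have v': "walk_of le lab c (P - {q} - {p}) v"
        using v by (simp add: Diff_insert2[symmetric] insert_commute)
      obtain v1' where v1': "insertion (lab q) v v1'" "walk_of le lab c (P - {p}) v1'"
        using walk_of_add_exists[OF pyrp pq v] by blast
      obtain v2' where v2': "insertion (lab p) v v2'" "walk_of le lab c (P - {q}) v2'"
        using walk_of_add_exists[OF pyrq qp v'] by blast
      \<comment> \<open>By induction, \<open>v1\<close> and \<open>v2\<close> do not depend on the
        order of insertion, so each may be taken to arise from \<open>v\<close> by inserting the
        other piece last.\<close>
      have eq: "v1' = v1" "v2' = v2"
        using less.hyps[OF card[OF p(1)] v1'(2) p(3)] less.hyps[OF card[OF q(1)] v2'(2) q(3)] .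
      have "loop_edges (lab p) \<inter> loop_edges (lab q) = {}"
        using minimal_pieces_not_conc[OF H p(1) q(1) neq] by (simp add: conc_def)
      then obtain w where "insertion (lab q) v2 w" "insertion (lab p) v1 w"
        using insertion_commute[OF loops[OF p(1)] loops[OF q(1)] _ v2'(1) v1'(1)] eq by blast
      then show ?thesis
        using insertion_unique[OF loops[OF p(1)], of v1] insertion_unique[OF loops[OF q(1)], of v2] p(4) q(4) by blast
    qed
  qed
qed

section \<open>Erasure of the walk of a pyramid\<close>

text \<open>If the piece \<open>p\<close> inserted last is not the one that erasure removes, then \<open>v\<close> repeats an edge, so
  the insertion of the erased piece \<open>q\<close> of the remaining pyramid happened within \<open>v\<close>. Hence \<open>p\<close> and
  \<open>q\<close> share no edge and the two insertions can be swapped.\<close>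
lemma walk_of_final_insertion:
  assumes "walk_of le lab c P w"
  shows "(\<exists>t. P = {t} \<and> w = c) \<or> (\<exists>p w'. minimal_piece P le p \<and> P \<noteq> {p} \<and>
    walk_of le lab c (P - {p}) w' \<and> final_insertion (lab p) w' w)"
  using assms
proof (induction rule: walk_of.induct)
  case (add P p w' w)
  note pyr = add.hyps(1) and p = add.hyps(2,3)
  note H = pyramid_heap[OF pyr] and H' = pyramid_heap[OF walk_of_pyramid[OF add.hyps(4)]]
  show ?case
  proof (cases "final_insertion (lab p) w' w")
    case True
    then show ?thesis
      using add.hyps by blast
  next
    case False
    have p_loop: "lab p \<in> loops E src tgt"
      using heap_loops[OF H] p(1) by (simp add: minimal_piece_def)
    from add.IH show ?thesis
    proof (elim disjE exE conjE)
      fix t assume t: "P - {p} = {t}" "w' = c"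
      \<comment> \<open>The remaining walk is the mark of the top piece, so \<open>v\<close> repeats
        no edge, which is all that \<open>final_insertion\<close> demands beyond
        \<open>insertion\<close>.\<close>
      have "edge_simple w'"
        using walk_of_pyramid[OF add.hyps(4)] pyramid_singleton_mark(2) unfolding t by blast
      moreover obtain u d c' v where "w' = u @ d # v" "w = u @ d # c' @ d # v" "d # c' \<in> lab p"
          "loop_edges (lab p) \<inter> fst ` set v = {}"
        using add.hyps(5) by (rule insertionE)
      moreover have "distinct (map fst v)"
        using calculation by (simp add: edge_simple_def)
      ultimately have "final_insertion (lab p) w' w"
        unfolding final_insertion_def by (intro exI conjI)
      with False show ?thesis ..
    next
      fix q w2 assume q: "minimal_piece (P - {p}) le q" "P - {p} \<noteq> {q}"
        "walk_of le lab c (P - {p} - {q}) w2" "final_insertion (lab q) w2 w'"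
      have qP: "q \<in> P" "q \<noteq> p"
        using q(1) by (auto simp: minimal_piece_def)
      have q_loop: "lab q \<in> loops E src tgt"
        using heap_loops[OF H qP(1)] .
      note comm = final_insertion_commute[OF p_loop q_loop add.hyps(5) False q(4)]
      from comm(2) obtain w1 where w1: "insertion (lab p) w2 w1" "final_insertion (lab q) w1 w"
        by blast
      \<comment> \<open>So far \<open>q\<close> is minimal only among the pieces other than
        \<open>p\<close>. A chain from \<open>p\<close> to \<open>q\<close> would begin with a piece
        concurrent with \<open>p\<close> and below \<open>q\<close>, hence with \<open>q\<close>
        itself, but \<open>p\<close> and \<open>q\<close> share no edge.\<close>
      have "\<not> le p q"
      proof
        assume "le p q"
        then obtain y where y: "y \<in> P - {p}" "conc lab p y" "le y q"
          using minimal_piece_le_iff[OF H p(1) qP(1)] qP(2) by blast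
        then have "y = q"
          using q(1) by (auto simp: minimal_piece_def)
        with y(2) comm(1) show False
          by (simp add: conc_def)
      qed
      then have qmin: "minimal_piece P le q"
        using q(1) by (auto simp: minimal_piece_def)
      have qne: "P \<noteq> {q}"
        using p(1) qP by (auto simp: minimal_piece_def)
      note pq = pyramid_remove_two[OF pyr qmin qne p qP(2)]
      have "walk_of le lab c (P - {q} - {p}) w2"
        using q(3) by (simp add: Diff_insert2[symmetric] insert_commute)
      then have "walk_of le lab c (P - {q}) w1"
        using pyramid_remove_minimal(1)[OF pyr qmin qne] pq w1(1) by (blast intro: walk_of.add)
      then show ?thesis
        using qmin qne w1(2) by blast
    qed
  qed
qed blast

text \<open>The property \<open>edge_simple w\<close> separates the two cases, so two pyramids with
  the same walk always fall into the same case.\<close>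

lemma walk_of_edge_simple_or_final_insertion:
  assumes "walk_of le lab c P w"
  obtains t where "P = {t}" "w = c" "edge_simple w"
  | p w' where "minimal_piece P le p" "P \<noteq> {p}" "lab p \<in> loops E src tgt"
    "walk_of le lab c (P - {p}) w'" "final_insertion (lab p) w' w" "\<not> edge_simple w"
  using walk_of_final_insertion[OF assms]
proof (elim disjE exE conjE)
  fix t assume "P = {t}" "w = c"
  with that(1) show ?thesis
    using walk_of_pyramid[OF assms] pyramid_singleton_mark(2) by blast
next
  fix p w' assume *: "minimal_piece P le p" "P \<noteq> {p}" "walk_of le lab c (P - {p}) w'" "final_insertion (lab p) w' w"
  have "lab p \<in> loops E src tgt"
    using heap_loops[OF pyramid_heap[OF walk_of_pyramid[OF assms]]] *(1) by (simp add: minimal_piece_def)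
  with * that(2) show ?thesis
    using insertion_not_edge_simple[OF final_insertion_insertion] by blast
qed

lemma card_remove_minimal_less:
  assumes "walk_of le lab c P w" "minimal_piece P le p"
  shows "card (P - {p}) < card P"
  using heap_finite[OF pyramid_heap[OF walk_of_pyramid[OF assms(1)]]] assms(2)
  by (intro card_Diff1_less) (simp_all add: minimal_piece_def)

lemma walk_of_erasable: "walk_of le lab c P w \<Longrightarrow> erasable w"
proof (induction "card P" arbitrary: P w rule: less_induct)
  case less
  from less.prems show ?case
  proof (cases rule: walk_of_edge_simple_or_final_insertion)
    case 1
    then show ?thesis by (blast intro: erasable.stop)
  next
    case (2 p w')
    then show ?thesis
      using less.hyps[OF card_remove_minimal_less[OF less.prems 2(1)] 2(4)]
        erasable_final_insertion by blast
  qed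
qed

section \<open>Isomorphic pyramids and their common walk\<close>

lemma pyramid_image:
  assumes pyr: "pyramid P le lab c" and inj: "inj_on f P"
    and lab: "\<forall>p\<in>P. lab' (f p) = lab p" and le: "\<forall>p\<in>P. \<forall>q\<in>P. le' (f p) (f q) \<longleftrightarrow> le p q"
  shows "pyramid (f ` P) le' lab' c"
proof -
  note H = pyramid_heap[OF pyr]
  have conc: "conc lab' (f p) (f q) \<longleftrightarrow> conc lab p q" if "p \<in> P" "q \<in> P" for p q
    using lab that by (simp add: conc_def)
  have "heap (f ` P) le' lab'"
  proof (rule heapI)
    show "finite (f ` P)"
      using heap_finite[OF H] by simp
    show "lab' p \<in> loops E src tgt" if "p \<in> f ` P" for p
      using that lab heap_loops[OF H] by auto
    show "le' p p" if "p \<in> f ` P" for p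
      using that le heap_refl[OF H] by auto
    show "p = q" if "p \<in> f ` P" "q \<in> f ` P" "le' p q" "le' q p" for p q
    proof -
      from that(1,2) obtain p0 q0 where *: "p0 \<in> P" "q0 \<in> P" "p = f p0" "q = f q0"
        by (elim imageE)
      then show ?thesis
        using that(3,4) le heap_antisym[OF H, of p0 q0] by simp
    qed
    show "le' p r" if "p \<in> f ` P" "q \<in> f ` P" "r \<in> f ` P" "le' p q" "le' q r" for p q r
    proof -
      from that(1-3) obtain p0 q0 r0 where *: "p0 \<in> P" "q0 \<in> P" "r0 \<in> P" "p = f p0" "q = f q0" "r = f r0"
        by (elim imageE)
      then show ?thesis
        using that(4,5) le heap_trans[OF H, of p0 q0 r0] by simp
    qed
    show "le' p q \<or> le' q p" if "p \<in> f ` P" "q \<in> f ` P" "conc lab' p q" for p q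
    proof -
      from that(1,2) obtain p0 q0 where *: "p0 \<in> P" "q0 \<in> P" "p = f p0" "q = f q0"
        by (elim imageE)
      then show ?thesis
        using that(3) le conc heap_comparable[OF H, of p0 q0] by simp
    qed
    show "\<exists>y\<in>f ` P. y \<noteq> p \<and> le' p y \<and> conc lab' p y \<and> le' y q"
      if pq: "p \<in> f ` P" "q \<in> f ` P" "le' p q" "p \<noteq> q" for p q
    proof -
      from pq(1,2) obtain p0 q0 where *: "p0 \<in> P" "q0 \<in> P" "p = f p0" "q = f q0"
        by (elim imageE)
      then obtain y where "y \<in> P" "y \<noteq> p0" "le p0 y" "conc lab p0 y" "le y q0"
        using heap_cover[OF H, of p0 q0] pq(3,4) le by auto
      then show ?thesis
        using * le conc inj by (intro bexI[of _ "f y"]) (simp_all add: inj_on_eq_iff)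
    qed
  qed
  moreover from pyr obtain t where "t \<in> P" "\<forall>q\<in>P. le q t" "c \<in> lab t"
    unfolding pyramid_iff by blast
  then have "\<exists>t\<in>f ` P. (\<forall>q\<in>f ` P. le' q t) \<and> c \<in> lab' t"
    using lab le by (intro bexI[of _ "f t"]) simp_all
  ultimately show ?thesis
    unfolding pyramid_iff by (rule conjI)
qed

text \<open>Besides invariance under isomorphism, the case \<open>f = id\<close> shows that only the
  restrictions of \<open>le\<close> and \<open>lab\<close> to \<open>P\<close> matter.\<close>

lemma walk_of_image:
  "walk_of le lab c P w \<Longrightarrow> inj_on f P \<Longrightarrow> \<forall>p\<in>P. lab' (f p) = lab p \<Longrightarrow>
    \<forall>p\<in>P. \<forall>q\<in>P. le' (f p) (f q) \<longleftrightarrow> le p q \<Longrightarrow> walk_of le' lab' c (f ` P) w"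
proof (induction rule: walk_of.induct)
  case (single t)
  have "pyramid (f ` {t}) le' lab' c"
    using single by (rule pyramid_image)
  then show ?case
    using walk_of.single[of "f t" le' lab' c] by simp
next
  case (add P p w' w)
  have p: "p \<in> P"
    using add.hyps(2) by (simp add: minimal_piece_def)
  have img: "f ` (P - {p}) = f ` P - {f p}"
    using add.prems(1) p by (auto simp: inj_on_def)
  show ?case
  proof (rule walk_of.add)
    show "pyramid (f ` P) le' lab' c"
      using add.hyps(1) add.prems by (rule pyramid_image)
    show "minimal_piece (f ` P) le' (f p)"
      using add.hyps(2) add.prems by (auto simp: minimal_piece_def)
    show "f ` P \<noteq> {f p}"
    proof
      assume "f ` P = {f p}"
      then have "\<forall>q\<in>P. q = p"
        using add.prems(1) p by (auto simp: inj_on_def)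
      with p add.hyps(3) show False by blast
    qed
    show "walk_of le' lab' c (f ` P - {f p}) w'"
      unfolding img[symmetric] using add.prems by (intro add.IH) (auto simp: inj_on_def)
    show "insertion (lab' (f p)) w' w"
      using add.hyps(5) add.prems(2) p by simp
  qed
qed

lemma walk_of_mp_iso:
  assumes "walk_of le lab c P w" "mp_iso (P, le, lab, c) (P', le', lab', c')"
  shows "walk_of le' lab' c' P' w"
proof -
  from assms(2) obtain f where f: "c = c'" "bij_betw f P P'" "\<forall>p\<in>P. lab' (f p) = lab p"
    "\<forall>p\<in>P. \<forall>q\<in>P. le' (f p) (f q) \<longleftrightarrow> le p q"
    unfolding mp_iso_def prod.case by (elim conjE exE) (rule that)
  then show ?thesis
    using walk_of_image[OF assms(1), of f lab' le'] by (simp add: bij_betw_def)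
qed

text \<open>Extend the isomorphism by \<open>p\<close> to \<open>p'\<close>. By
  \<open>minimal_piece_le_iff\<close>, what lies above the new piece depends only on labels and on
  the order of the other pieces, both of which are preserved; nothing else lies below it.\<close>

lemma mp_iso_extend:
  assumes H: "heap P le lab" and H': "heap P' le' lab'"
    and p: "minimal_piece P le p" and p': "minimal_piece P' le' p'" and eq: "lab p = lab' p'"
    and iso: "mp_iso (P - {p}, le, lab, c) (P' - {p'}, le', lab', c')"
  shows "mp_iso (P, le, lab, c) (P', le', lab', c')"
proof -
  from iso obtain f where f: "c = c'" "bij_betw f (P - {p}) (P' - {p'})"
    "\<forall>q\<in>P - {p}. lab' (f q) = lab q"
    "\<forall>a\<in>P - {p}. \<forall>b\<in>P - {p}. le' (f a) (f b) \<longleftrightarrow> le a b"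
    unfolding mp_iso_def prod.case by (elim conjE exE) (rule that)
  have pP: "p \<in> P" "p' \<in> P'"
    using p p' by (simp_all add: minimal_piece_def)
  define g where "g = f(p := p')"
  have gp: "g p = p'" and gf: "\<And>q. q \<in> P - {p} \<Longrightarrow> g q = f q"
    by (auto simp: g_def)
  have f_img: "f ` (P - {p}) = P' - {p'}"
    using f(2) by (simp add: bij_betw_def)
  have fP: "f q \<in> P' - {p'}" if "q \<in> P - {p}" for q
    using f_img that by blast
  have "bij_betw g (P - {p}) (P' - {p'})"
    using f(2) bij_betw_cong[of "P - {p}" g f "P' - {p'}"] gf by blast
  then have "bij_betw g (insert p (P - {p})) (insert p' (P' - {p'}))"
    using notIn_Un_bij_betw[of p "P - {p}" g "P' - {p'}"] gp by simp
  then have bij: "bij_betw g P P'"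
    using pP by (simp add: insert_absorb)
  have lab: "\<forall>q\<in>P. lab' (g q) = lab q"
    using f(3) eq by (simp add: g_def)
  have "le' (g a) (g b) \<longleftrightarrow> le a b" if ab: "a \<in> P" "b \<in> P" for a b
  proof (cases "a = p")
    case True
    have "le' p' (g b) \<longleftrightarrow> g b = p' \<or> (\<exists>y\<in>P' - {p'}. conc lab' p' y \<and> le' y (g b))"
      using bij ab by (intro minimal_piece_le_iff[OF H' p']) (auto simp: bij_betw_def)
    also have "\<dots> \<longleftrightarrow> b = p \<or> (\<exists>y\<in>P - {p}. conc lab p y \<and> le y b)"
    proof (cases "b = p")
      case False
      then have b: "b \<in> P - {p}" using ab by simp
      have "conc lab' p' (f y) \<longleftrightarrow> conc lab p y" if "y \<in> P - {p}" for y
        using f(3) eq that by (simp add: conc_def)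
      then have "(\<exists>y\<in>P - {p}. conc lab' p' (f y) \<and> le' (f y) (f b)) \<longleftrightarrow>
          (\<exists>y\<in>P - {p}. conc lab p y \<and> le y b)"
        using f(4) b by (intro bex_cong) simp_all
      moreover have "f b \<noteq> p'"
        using fP[OF b] by simp
      ultimately show ?thesis
        using False unfolding gf[OF b] f_img[symmetric] bex_simps by simp
    qed (simp add: gp)
    also have "\<dots> \<longleftrightarrow> le p b"
      using minimal_piece_le_iff[OF H p ab(2)] by simp
    finally show ?thesis
      using True gp by simp
  next
    case False
    show ?thesis
    proof (cases "b = p")
      case True
      have "\<not> le a p"
        using p False ab by (auto simp: minimal_piece_def)
      moreover have "\<not> le' (f a) p'"
        using p' fP[of a] False ab by (auto simp: minimal_piece_def)
      ultimately show ?thesis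
        using True False gp gf[of a] ab by simp
    qed (use False f(4) gf ab in simp)
  qed
  with bij lab f(1) show ?thesis
    unfolding mp_iso_def prod.case by blast
qed

text \<open>The walk alone determines the erased loop and the remaining walk
  (\<open>final_insertion_unique\<close>), so both pyramids lose minimal pieces with the same label
  and induction applies to the rest.\<close>

lemma walk_of_determines_pyramid:
  "walk_of le lab c P w \<Longrightarrow> walk_of le' lab' c' P' w \<Longrightarrow> mp_iso (P, le, lab, c) (P', le', lab', c')"
proof (induction "card P" arbitrary: P P' w rule: less_induct)
  case less
  note W = less.prems(1) and W' = less.prems(2)
  note H = pyramid_heap[OF walk_of_pyramid[OF W]] and H' = pyramid_heap[OF walk_of_pyramid[OF W']]
  from W show ?case
  proof (cases rule: walk_of_edge_simple_or_final_insertion)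
    case (1 t)
    note t = 1
    from W' show ?thesis
    proof (cases rule: walk_of_edge_simple_or_final_insertion)
      case (1 t')
      have "lab t = loop_of c" "lab' t' = loop_of c'"
        using walk_of_pyramid[OF W] walk_of_pyramid[OF W'] unfolding t(1) 1(1)
        by - (rule pyramid_singleton_mark(4), assumption)+
      moreover have "le t t" "le' t' t'"
        using heap_refl[OF H] heap_refl[OF H'] t(1) 1(1) by simp_all
      ultimately show ?thesis
        using t 1 unfolding mp_iso_def prod.case by (intro conjI exI[of _ "\<lambda>_. t'"]) simp_all
    qed (use t in blast)
  next
    case (2 p v)
    note p = 2
    from W' show ?thesis
    proof (cases rule: walk_of_edge_simple_or_final_insertion)
      case (2 p' v')
      note eq = final_insertion_unique[OF p(5,3) 2(5,3)]
      have "mp_iso (P - {p}, le, lab, c) (P' - {p'}, le', lab', c')"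
        using less.hyps[OF card_remove_minimal_less[OF W p(1)] p(4)] 2(4) eq(2) by simp
      then show ?thesis
        by (rule mp_iso_extend[OF H H' p(1) 2(1) eq(1)])
    qed (use p in blast)
  qed
qed

section \<open>Reading a pyramid off an erasure sequence\<close>

text \<open>The order \<open>le'\<close> is the one forced by \<open>minimal_piece_le_iff\<close>.
  The conjunct \<open>b \<noteq> p\<close> overrides the arbitrary values that \<open>le\<close> may
  take at the fresh name \<open>p\<close>.\<close>

lemma pyramid_insert:
  assumes pyr: "pyramid P le lab c" and p: "p \<notin> P" and L: "L \<in> loops E src tgt"
    and meets: "\<exists>q\<in>P. loop_edges L \<inter> loop_edges (lab q) \<noteq> {}"
  defines "lab' \<equiv> lab(p := L)"
    and "le' \<equiv> \<lambda>a b. if a = p then b = p \<or> (\<exists>q\<in>P. loop_edges L \<inter> loop_edges (lab q) \<noteq> {} \<and> le q b)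
      else b \<noteq> p \<and> le a b"
  shows "pyramid (insert p P) le' lab' c" "minimal_piece (insert p P) le' p"
proof -
  note H = pyramid_heap[OF pyr]
  have conc: "conc lab' a b \<longleftrightarrow> conc lab a b" if "a \<in> P" "b \<in> P" for a b
    using p that by (auto simp: conc_def lab'_def)
  have conc_p: "conc lab' p b \<longleftrightarrow> loop_edges L \<inter> loop_edges (lab b) \<noteq> {}" if "b \<in> P" for b
    using p that by (auto simp: conc_def lab'_def)
  have le: "le' a b \<longleftrightarrow> le a b" "\<not> le' a p" if "a \<in> P" "b \<in> P" for a b
    using p that by (auto simp: le'_def)
  have le_p: "le' p b \<longleftrightarrow> (\<exists>q\<in>P. conc lab' p q \<and> le q b)" if "b \<in> P" for b
    using p that conc_p by (auto simp: le'_def)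
  have le_pp: "le' p p"
    by (simp add: le'_def)
  show "minimal_piece (insert p P) le' p"
    using le(2) by (auto simp: minimal_piece_def)
  have "heap (insert p P) le' lab'"
  proof (rule heapI)
    show "finite (insert p P)"
      using heap_finite[OF H] by simp
    show "lab' a \<in> loops E src tgt" if "a \<in> insert p P" for a
      using that heap_loops[OF H] L by (auto simp: lab'_def)
    show "le' a a" if "a \<in> insert p P" for a
      using that le_pp le heap_refl[OF H] by blast
    show "a = b" if "a \<in> insert p P" "b \<in> insert p P" "le' a b" "le' b a" for a b
      using that le heap_antisym[OF H, of a b] by blast
    show "le' a r" if "a \<in> insert p P" "b \<in> insert p P" "r \<in> insert p P" "le' a b" "le' b r" for a b r
    proof -
      consider "a \<in> P" | "a = p" "b = p" | "a = p" "b \<in> P"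
        using \<open>a \<in> insert p P\<close> \<open>b \<in> insert p P\<close> by blast
      then show ?thesis
      proof cases
        case 1
        then have "b \<in> P" "r \<in> P"
          using that le(2) by blast+
        then show ?thesis
          using 1 that(4,5) le(1) heap_trans[OF H, of a b r] by simp
      next
        case 2
        then show ?thesis using that(5) by simp
      next
        case 3
        then have "r \<in> P"
          using that le(2) by blast
        from 3 that(4) obtain q where q: "q \<in> P" "conc lab' p q" "le q b"
          using le_p by blast
        then have "le q r"
          using 3 that(5) le(1) \<open>r \<in> P\<close> heap_trans[OF H, of q b r] by simp
        then show ?thesis
          using 3 le_p[OF \<open>r \<in> P\<close>] q by blast
      qed
    qed
    show "le' a b \<or> le' b a" if "a \<in> insert p P" "b \<in> insert p P" "conc lab' a b" for a b
    proof -
      have *: "le' p x" if "x \<in> P" "conc lab' p x" for x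
        using le_p[OF that(1)] heap_refl[OF H that(1)] that by blast
      show ?thesis
        using that * conc_sym[of lab' a b] conc le heap_comparable[OF H, of a b] le_pp by blast
    qed
    show "\<exists>y\<in>insert p P. y \<noteq> a \<and> le' a y \<and> conc lab' a y \<and> le' y b"
      if ab: "a \<in> insert p P" "b \<in> insert p P" "le' a b" "a \<noteq> b" for a b
    proof (cases "a = p")
      case True
      then have "b \<in> P"
        using ab by simp
      then obtain q where q: "q \<in> P" "conc lab' p q" "le q b"
        using ab(3) True le_p by blast
      then have "le' p q"
        using le_p[OF q(1)] heap_refl[OF H q(1)] by blast
      then show ?thesis
        using q le(1) \<open>b \<in> P\<close> p True by (intro bexI[of _ q]) auto
    next
      case False
      then have a: "a \<in> P" and b: "b \<in> P"
        using ab le(2) by blast+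
      then obtain y where "y \<in> P" "y \<noteq> a" "le a y" "conc lab a y" "le y b"
        using heap_cover[OF H, of a b] ab le(1) by auto
      then show ?thesis
        using le(1) conc a b by (intro bexI[of _ y]) auto
    qed
  qed
  moreover obtain t where t: "t \<in> P" "\<forall>q\<in>P. le q t" "c \<in> lab t"
    using pyr unfolding pyramid_iff by blast
  moreover have "le' p t"
    using meets t(2) conc_p le_p[OF t(1)] by blast
  ultimately have "heap (insert p P) le' lab' \<and> (\<forall>q\<in>insert p P. le' q t) \<and> c \<in> lab' t"
    using le(1) p by (auto simp: lab'_def)
  with t(1) show "pyramid (insert p P) le' lab' c"
    unfolding pyramid_iff by blast
qed

lemma erasable_walk_of_exists:
  "erasable w \<Longrightarrow> closed_walk E src tgt w \<Longrightarrow> \<exists>P le lab c. walk_of le lab c P w"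
proof (induction rule: erasable.induct)
  case (stop w)
  let ?lab = "\<lambda>_ :: nat. loop_of w"
  have L: "loop_of w \<in> loops E src tgt"
    using stop by (simp add: loop_of_in_loops)
  have "heap {0} (\<lambda>_ _. True) ?lab"
  proof (rule heapI)
    show "loop_of w \<in> loops E src tgt" by (fact L)
  qed blast+
  then have "pyramid {0} (\<lambda>_ _. True) ?lab w"
    unfolding pyramid_iff by (simp add: mem_loop_of_self)
  then show ?case
    by (blast intro: walk_of.single)
next
  case (step w)
  let ?w' = "take (kidx w) w @ drop (midx w) w"
  obtain L where L: "L \<in> loops E src tgt" and last: "final_insertion L ?w' w" and "closed_walk E src tgt ?w'"
    using erasure_step[OF step.prems step.hyps(1,2)] .
  then obtain P le lab c where W: "walk_of le lab c P ?w'"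
    using step.IH by blast
  note insertion = final_insertion_insertion[OF last]
  have pyr: "pyramid P le lab c"
    using W by (rule walk_of_pyramid)
  obtain p where p: "p \<notin> P"
    using heap_finite[OF pyramid_heap[OF pyr]] ex_new_if_finite infinite_UNIV_nat by blast
  obtain u d c' v where "?w' = u @ d # v" "d # c' \<in> L"
    using insertion by (rule insertionE)
  moreover have "loop_edges L = fst ` set (d # c')"
    using L calculation(2) by (rule loopsE)
  \<comment> \<open>Erasure keeps one copy of \<open>d\<close>, so the shorter walk still shares an
    edge with the erased loop, and therefore so does some piece.\<close>
  ultimately have "fst d \<in> loop_edges L" "fst d \<in> fst ` set ?w'"
    by simp_all
  then have meets: "\<exists>q\<in>P. loop_edges L \<inter> loop_edges (lab q) \<noteq> {}"
    unfolding walk_of_edges[OF W] by blast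
  define lab' where "lab' = lab(p := L)"
  define le' where "le' = (\<lambda>a b. if a = p then b = p \<or> (\<exists>q\<in>P. loop_edges L \<inter> loop_edges (lab q) \<noteq> {} \<and> le q b)
      else b \<noteq> p \<and> le a b)"
  note new = pyramid_insert[OF pyr p L meets, folded lab'_def le'_def]
  \<comment> \<open>The new order and labels agree with the old ones on \<open>P\<close>, so the
    walk is transported along the identity.\<close>
  have "walk_of le' lab' c (id ` P) ?w'"
    using W
  proof (rule walk_of_image)
    show "\<forall>q\<in>P. lab' (id q) = lab q"
      using p by (auto simp: lab'_def)
    show "\<forall>a\<in>P. \<forall>b\<in>P. le' (id a) (id b) \<longleftrightarrow> le a b"
      using p by (auto simp: le'_def)
  qed simp
  then have "walk_of le' lab' c (insert p P - {p}) ?w'"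
    using p by simp
  moreover have "insert p P \<noteq> {p}"
    using meets p by blast
  moreover have "insertion (lab' p) ?w' w"
    using insertion by (simp add: lab'_def)
  ultimately have "walk_of le' lab' c (insert p P) w"
    using new by (blast intro: walk_of.add)
  then show ?case
    by blast
qed

lemma totally_nb_iff_walk_of:
  "totally_nb E src tgt w \<longleftrightarrow> (\<exists>P le lab c. walk_of le lab c P w)"
  unfolding totally_nb_def using erasable_walk_of_exists walk_of_closed walk_of_erasable by blast

end

theorem mainTheorem15:
  fixes V :: "'v set" and E :: "'e set" and src tgt :: "'e \<Rightarrow> 'v"
  assumes "finite_graph V E src tgt"
  shows "\<exists>\<Phi> :: 'e dwalk \<Rightarrow> 'e marked_pyramid.
    (\<forall>w. totally_nb E src tgt w \<longrightarrow> is_marked_pyramid E src tgt (\<Phi> w)) \<and>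
    (\<forall>w w'. totally_nb E src tgt w \<and> totally_nb E src tgt w' \<and> mp_iso (\<Phi> w) (\<Phi> w')
        \<longrightarrow> w = w') \<and>
    (\<forall>X. is_marked_pyramid E src tgt X \<longrightarrow>
        (\<exists>w. totally_nb E src tgt w \<and> mp_iso (\<Phi> w) X)) \<and>
    (\<forall>w. totally_nb E src tgt w \<longrightarrow>
        (\<forall>e\<in>E. walk_edge_count w e = pyr_edge_count (\<Phi> w) e))"
proof -
  \<comment> \<open>The names of the pieces are arbitrary numbers, so a walk fixes its pyramid only
    up to \<open>mp_iso\<close>. The choice in \<open>\<Phi>\<close> is harmless because injectivity
    and surjectivity are proved for \<open>R\<close>, whose values at one walk are all
    isomorphic.\<close>
  define R where "R w X \<longleftrightarrow> (case X of (P, le, lab, c) \<Rightarrow> walk_of E src tgt le lab c P w)" for w X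
  define \<Phi> where "\<Phi> w = (SOME X. R w X)" for w
  have R_total: "R w (\<Phi> w)" if "totally_nb E src tgt w" for w
  proof -
    obtain P le lab c where "walk_of E src tgt le lab c P w"
      using \<open>totally_nb E src tgt w\<close> totally_nb_iff_walk_of[of E src tgt w] by blast
    then have "R w (P, le, lab, c)"
      by (simp add: R_def)
    then show ?thesis
      unfolding \<Phi>_def by (rule someI)
  qed
  have R_totally_nb: "totally_nb E src tgt w" if "R w X" for w X
    using that totally_nb_iff_walk_of[of E src tgt w] unfolding R_def by (cases X) auto
  have R_pyramid: "is_marked_pyramid E src tgt X" if "R w X" for w X
    using that walk_of_pyramid unfolding R_def by (cases X) auto
  have R_count: "walk_edge_count w e = pyr_edge_count X e" if "R w X" for w X e
    using that walk_of_edge_count unfolding R_def pyr_edge_count_def by (cases X) auto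
  have R_inj: "w = w'" if "R w X" "R w' X'" "mp_iso X X'" for w w' X X'
  proof -
    obtain P le lab c P' le' lab' c' where X: "X = (P, le, lab, c)" "X' = (P', le', lab', c')"
      by (cases X; cases X')
    have "walk_of E src tgt le' lab' c' P' w"
      using that(1,3) unfolding X R_def prod.case by (rule walk_of_mp_iso)
    moreover have "walk_of E src tgt le' lab' c' P' w'"
      using that(2) unfolding X R_def prod.case .
    ultimately show ?thesis
      by (rule walk_of_unique)
  qed
  have R_iso: "mp_iso X X'" if "R w X" "R w X'" for w X X'
  proof -
    obtain P le lab c P' le' lab' c' where X: "X = (P, le, lab, c)" "X' = (P', le', lab', c')"
      by (cases X; cases X')
    show ?thesis
      using that unfolding X R_def prod.case by (rule walk_of_determines_pyramid)
  qed
  have R_surj: "\<exists>w. R w X" if "is_marked_pyramid E src tgt X" for X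
  proof -
    obtain P le lab c where X: "X = (P, le, lab, c)"
      by (cases X)
    obtain w where "walk_of E src tgt le lab c P w"
      using \<open>is_marked_pyramid E src tgt X\<close> unfolding X by (rule walk_of_exists)
    then have "R w X"
      unfolding X R_def prod.case .
    then show ?thesis ..
  qed
  show ?thesis
  proof (intro exI[of _ \<Phi>] conjI allI impI ballI)
    show "is_marked_pyramid E src tgt (\<Phi> w)" if "totally_nb E src tgt w" for w
      using R_total[OF that] by (rule R_pyramid)
    show "w = w'" if "totally_nb E src tgt w \<and> totally_nb E src tgt w' \<and> mp_iso (\<Phi> w) (\<Phi> w')" for w w'
      using that R_total R_inj by blast
    show "\<exists>w. totally_nb E src tgt w \<and> mp_iso (\<Phi> w) X" if "is_marked_pyramid E src tgt X" for X
      using R_surj[OF that] R_totally_nb R_total R_iso by blast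
    show "walk_edge_count w e = pyr_edge_count (\<Phi> w) e" if "totally_nb E src tgt w" for w e
      using R_total[OF that] by (rule R_count)
  qed
qed

end
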